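(* Let $K$ be a field (of arbitrary characteristic) and $r\ge 2$. Let $\mathcal{F}$ (nonempty) and $\mathcal{G}$ be two strictly increasing finite sequences of pairs $(\underline{i},j)\in\mathbb{N}^r\times\mathbb{N}$ for the anti-lexicographic order, such that every element of $\mathcal{F}$ is of the form $(\underline{i},j)$ with $j\geq 1$ and every element of $\mathcal{G}$ is of the form $(\underline{i},0)$ with $|\underline{i}|>0$. Set $d_y:=\max\{j : (\underline{i},j)\in\mathcal{F}\}$, $d_x:=\max\{|\underline{i}| : (\underline{i},j)\in\mathcal{F}\cup\mathcal{G}\}$ and $N:=2d_xd_y$. Then there exist a finite set $\Lambda$ and a finite number of homogeneous polynomials $$\left(\left\{a_{\underline{i},j}^{(\lambda)}\in\mathbb{Z}[C_{(0,\ldots,0,1)},\ldots,C_{(N,0,\ldots,0)}] : (\underline{i},j)\in\mathcal{F}\cup\mathcal{G}\right\}\right)_{\lambda\in\Lambda}$$ (where the variables $C_{\underline{n}}$ are listed with indices ordered by $\leq_{\mathrm{grlex}}$), of total degree $$\deg a_{\underline{i},j}^{(\lambda)}\leq \tfrac{1}{2}d_y(d_y+1)\binom{d_x+r}{r}-1\ \text{ for }(\underline{i},j)\in\mathcal{F},\qquad \deg a_{\underline{i},0}^{(\lambda)}\leq \tfrac{1}{2}d_y(d_y+1)\binom{d_x+r}{r}-1+|\underline{i}|\ \text{ for }(\underline{i},0)\in\mathcal{G},$$ such that, for any series $y_0=\sum_{\underline{n}\geq_{\mathrm{grlex}} (0,\ldots,0,1)} c_{\underline{n}}\underline{x}^{\underline{n}}\in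 K[[\underline{x}]]$ with $c_{(0,\ldots,0,1)}\neq 0$ which is algebraic relatively to $(\mathcal{F},\mathcal{G})$, there is $\lambda\in\Lambda$ such that the polynomial in $K[\underline{x},y]$ $$P^{(\lambda)}(\underline{x},y)=\sum_{(\underline{i},j) \in\mathcal{F}}a_{\underline{i},j}^{(\lambda)}(c_{(0,\ldots,0,1)},\ldots,c_{(N,0,\ldots,0)})\,\underline{x}^{\underline{i}}y^j+\sum_{(\underline{i},0) \in\mathcal{G}}a_{\underline{i},0}^{(\lambda)}(c_{(0,\ldots,0,1)},\ldots,c_{(N,0,\ldots,0)})\,\underline{x}^{\underline{i}}$$ is nonzero and vanishes at $y_0$.
   Context: Notation: $\mathbb{N}=\mathbb{Z}_{\ge 0}$, $\underline{x}=(x_1,\ldots,x_r)$, $\underline{x}^{\underline{n}}=x_1^{n_1}\cdots x_r^{n_r}$, $|\underline{n}|=n_1+\cdots+n_r$. The graded lexicographic order: $\underline{n}\leq_{\mathrm{grlex}}\underline{m}$ iff $|\underline{n}|<|\underline{m}|$, or $|\underline{n}|=|\underline{m}|$ and $\underline{n}$ is less than or equal to $\underline{m}$ lexicographically (comparing first coordinates first). Thus $(0,\ldots,0,1)$ is the smallest nonzero element of $\mathbb{N}^r$ and $(N,0,\ldots,0)$ is the largest element with $|\underline{n}|=N$. Pairs $(\underline{i},j)\in\mathbb{N}^r\times\mathbb{N}$ are ordered anti-lexicographically: $(\underline{i}_1,j_1)\leq_{\mathrm{alex}}(\underline{i}_2,j_2)$ iff $j_1<j_2$, or $j_1=j_2$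 and $\underline{i}_1\leq_{\mathrm{grlex}}\underline{i}_2$. A series $y_0=\sum_{\underline{n}\geq_{\mathrm{grlex}} (0,\ldots,0,1)} c_{\underline{n}}\underline{x}^{\underline{n}}\in K[[\underline{x}]]$ with $c_{(0,\ldots,0,1)}\neq 0$ is algebraic relatively to $(\mathcal{F},\mathcal{G})$ if there exists a polynomial $P(\underline{x},y)=\sum_{(\underline{i},j)\in\mathcal{F}\cup\mathcal{G}} a_{\underline{i},j}\underline{x}^{\underline{i}}y^j\in K[\underline{x},y]\setminus\{0\}$ such that $P(\underline{x},y_0)=0$. *)

theory Defs
  imports Complex_Main "HOL-Library.Poly_Mapping"
    "HOL-Computational_Algebra.Polynomial"
begin

text \<open>
  Exponents are finitely supported functions on the naturals. The set of \<open>r\<close>-tuples of naturals is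
  identified with the exponents supported on \<open>{1..r}\<close>, so that \<open>lookup n k\<close> is the \<open>k\<close>-th coordinate
  of the tuple \<open>n\<close>; the tuples (0,...,0,1) and (N,0,...,0) are \<open>single r 1\<close> and \<open>single 1 N\<close>.
\<close>

type_synonym mindex = "nat \<Rightarrow>\<^sub>0 nat"

definition mindices :: "nat \<Rightarrow> mindex set" where
  "mindices r = {n. Poly_Mapping.keys n \<subseteq> {1..r}}"

definition mdeg :: "('v \<Rightarrow>\<^sub>0 nat) \<Rightarrow> nat" where
  "mdeg n = (\<Sum>v\<in>Poly_Mapping.keys n. Poly_Mapping.lookup n v)"

text \<open>
  The order \<open>\<le>\<close> that the library puts on finitely supported functions is the lexicographic one,
  where the coordinate of smallest index is compared first.
\<close>

definition grlex_le :: "mindex \<Rightarrow> mindex \<Rightarrow> bool" where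
  "grlex_le n m \<longleftrightarrow> mdeg n < mdeg m \<or> (mdeg n = mdeg m \<and> n \<le> m)"

definition alex_le :: "mindex \<times> nat \<Rightarrow> mindex \<times> nat \<Rightarrow> bool" where
  "alex_le p q \<longleftrightarrow> snd p < snd q \<or> (snd p = snd q \<and> grlex_le (fst p) (fst q))"

definition alex_less :: "mindex \<times> nat \<Rightarrow> mindex \<times> nat \<Rightarrow> bool" where
  "alex_less p q \<longleftrightarrow> alex_le p q \<and> p \<noteq> q"

text \<open>
  The elements are the series with arbitrary coefficients over the monomials in countably many
  variables, each monomial involving only finitely many of them; the series in \<open>x\<^sub>1, \<dots>, x\<^sub>r\<close> form
  the subset \<open>mseries_in r\<close>.
\<close>

typedef 'a mseries = "UNIV :: (mindex \<Rightarrow> 'a) set"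
  morphisms scoeff Abs_mseries ..

setup_lifting type_definition_mseries

lemma mseries_eq_iff: "f = g \<longleftrightarrow> (\<forall>n. scoeff f n = scoeff g n)"
  by (metis ext scoeff_inject)

lemma finite_mindex_splits: "finite {(a, b). a + b = (n :: mindex)}"
proof -
  let ?A = "{a :: mindex. \<forall>k. Poly_Mapping.lookup a k \<le> Poly_Mapping.lookup n k}"
  let ?S = "{f :: nat \<Rightarrow> nat. \<forall>k. (k \<in> Poly_Mapping.keys n \<longrightarrow> f k \<in> {..mdeg n}) \<and>
    (k \<notin> Poly_Mapping.keys n \<longrightarrow> f k = 0)}"
  have le: "Poly_Mapping.lookup n k \<le> mdeg n" if "k \<in> Poly_Mapping.keys n" for k
    unfolding mdeg_def using that by (intro member_le_sum) auto
  have "Poly_Mapping.lookup a \<in> ?S" if a: "a \<in> ?A" for a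
  proof -
    have "Poly_Mapping.lookup a k \<le> mdeg n" if "k \<in> Poly_Mapping.keys n" for k
      using a le[OF that] by (blast intro: order_trans)
    moreover have "Poly_Mapping.lookup a k = 0" if "k \<notin> Poly_Mapping.keys n" for k
      using a that by (auto simp: in_keys_iff dest: spec[of _ k])
    ultimately show ?thesis by simp
  qed
  hence "Poly_Mapping.lookup ` ?A \<subseteq> ?S" by (rule image_subsetI)
  moreover have "finite ?S"
    by (rule finite_set_of_finite_funs) auto
  ultimately have "finite (Poly_Mapping.lookup ` ?A)"
    by (rule finite_subset)
  hence fin: "finite ?A"
    by (rule finite_imageD) (simp add: inj_on_def lookup_inject)
  have "{(a, b). a + b = n} \<subseteq> ?A \<times> ?A"
    by (auto simp: lookup_add)
  thus ?thesis
    by (rule finite_subset) (intro finite_cartesian_product fin)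
qed

instantiation mseries :: (comm_ring_1) comm_ring_1
begin

lift_definition zero_mseries :: "'a mseries" is "\<lambda>_. 0" .
lift_definition one_mseries :: "'a mseries" is "\<lambda>n. if n = 0 then 1 else 0" .
lift_definition plus_mseries :: "'a mseries \<Rightarrow> 'a mseries \<Rightarrow> 'a mseries" is "\<lambda>f g n. f n + g n" .
lift_definition minus_mseries :: "'a mseries \<Rightarrow> 'a mseries \<Rightarrow> 'a mseries" is "\<lambda>f g n. f n - g n" .
lift_definition uminus_mseries :: "'a mseries \<Rightarrow> 'a mseries" is "\<lambda>f n. - f n" .
lift_definition times_mseries :: "'a mseries \<Rightarrow> 'a mseries \<Rightarrow> 'a mseries" is
  "\<lambda>f g n. \<Sum>(a, b)\<in>{(a, b). a + b = n}. f a * g b" .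

instance
proof
  fix f g h :: "'a mseries"
  have L: "scoeff (f * g * h) n =
      (\<Sum>(a, b, c)\<in>{(a, b, c). a + b + c = n}. scoeff f a * scoeff g b * scoeff h c)" for n
  proof -
    have "scoeff (f * g * h) n =
      (\<Sum>x\<in>{(a, b). a + b = n}. \<Sum>y\<in>{(c, d). c + d = fst x}.
         scoeff f (fst y) * scoeff g (snd y) * scoeff h (snd x))"
      by (simp add: times_mseries.rep_eq case_prod_beta sum_distrib_right)
    also have "\<dots> = (\<Sum>(x, y)\<in>(SIGMA x:{(a, b). a + b = n}. {(c, d). c + d = fst x}).
         scoeff f (fst y) * scoeff g (snd y) * scoeff h (snd x))"
      by (rule sum.Sigma) (auto intro: finite_mindex_splits)
    also have "\<dots> =
        (\<Sum>(a, b, c)\<in>{(a, b, c). a + b + c = n}. scoeff f a * scoeff g b * scoeff h c)"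
      by (rule sum.reindex_bij_witness[where
            i = "\<lambda>(a, b, c). ((a + b, c), (a, b))" and j = "\<lambda>(x, y). (fst y, snd y, snd x)"]) auto
    finally show ?thesis .
  qed
  have R: "scoeff (f * (g * h)) n =
      (\<Sum>(a, b, c)\<in>{(a, b, c). a + b + c = n}. scoeff f a * scoeff g b * scoeff h c)" for n
  proof -
    have "scoeff (f * (g * h)) n =
      (\<Sum>x\<in>{(a, b). a + b = n}. \<Sum>y\<in>{(c, d). c + d = snd x}.
         scoeff f (fst x) * (scoeff g (fst y) * scoeff h (snd y)))"
      by (simp add: times_mseries.rep_eq case_prod_beta sum_distrib_left)
    also have "\<dots> = (\<Sum>(x, y)\<in>(SIGMA x:{(a, b). a + b = n}. {(c, d). c + d = snd x}).
         scoeff f (fst x) * (scoeff g (fst y) * scoeff h (snd y)))"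
      by (rule sum.Sigma) (auto intro: finite_mindex_splits)
    also have "\<dots> =
        (\<Sum>(a, b, c)\<in>{(a, b, c). a + b + c = n}. scoeff f a * scoeff g b * scoeff h c)"
      by (rule sum.reindex_bij_witness[where
            i = "\<lambda>(a, b, c). ((a, b + c), (b, c))" and j = "\<lambda>(x, y). (fst x, fst y, snd y)"])
         (auto simp: add.assoc mult.assoc)
    finally show ?thesis .
  qed
  show "f * g * h = f * (g * h)"
    by (simp add: mseries_eq_iff L R)
  show "f * g = g * f"
  proof -
    have "(\<Sum>(a, b)\<in>{(a, b). a + b = n}. scoeff f a * scoeff g b) =
          (\<Sum>(a, b)\<in>{(a, b). a + b = n}. scoeff g a * scoeff f b)" for n
      by (rule sum.reindex_bij_witness[where i = "\<lambda>(a, b). (b, a)" and j = "\<lambda>(a, b). (b, a)"])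
         (auto simp: add.commute mult.commute)
    thus ?thesis by (simp add: mseries_eq_iff times_mseries.rep_eq)
  qed
  show "1 * f = f"
  proof -
    have "(\<Sum>(a, b)\<in>{(a, b). a + b = n}. (if a = 0 then 1 else 0) * scoeff f b) = scoeff f n" for n
    proof -
      have "(\<Sum>(a, b)\<in>{(a, b). a + b = n}. (if a = 0 then 1 else 0) * scoeff f b) =
            (\<Sum>(a, b)\<in>{(0 :: mindex, n)}. (if a = 0 then 1 else 0) * scoeff f b)"
        by (rule sum.mono_neutral_right[OF finite_mindex_splits]) (auto split: if_splits)
      thus ?thesis by simp
    qed
    thus ?thesis by (simp add: mseries_eq_iff times_mseries.rep_eq one_mseries.rep_eq)
  qed
  show "(f + g) * h = f * h + g * h"
    by (simp add: mseries_eq_iff times_mseries.rep_eq plus_mseries.rep_eq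
        distrib_right sum.distrib case_prod_beta)
  show "(0 :: 'a mseries) \<noteq> 1"
    by (auto simp: mseries_eq_iff zero_mseries.rep_eq one_mseries.rep_eq intro!: exI[of _ 0])
  show "f + g + h = f + (g + h)"
    by (simp add: mseries_eq_iff plus_mseries.rep_eq add.assoc)
  show "f + g = g + f"
    by (simp add: mseries_eq_iff plus_mseries.rep_eq add.commute)
  show "0 + f = f"
    by (simp add: mseries_eq_iff plus_mseries.rep_eq zero_mseries.rep_eq)
  show "- f + f = 0"
    by (simp add: mseries_eq_iff plus_mseries.rep_eq zero_mseries.rep_eq uminus_mseries.rep_eq)
  show "f - g = f + - g"
    by (simp add: mseries_eq_iff plus_mseries.rep_eq minus_mseries.rep_eq uminus_mseries.rep_eq)
qed

end

definition mseries_in :: "nat \<Rightarrow> 'a :: zero mseries set" where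
  "mseries_in r = {f. \<forall>n. scoeff f n \<noteq> 0 \<longrightarrow> n \<in> mindices r}"

text \<open>
  A polynomial over \<open>'a\<close> in variables indexed by \<open>'v\<close> is a finitely supported function from
  monomials \<open>'v \<Rightarrow>\<^sub>0 nat\<close> to coefficients; the library's product on \<open>\<Rightarrow>\<^sub>0\<close> is the convolution.
\<close>

type_synonym ('v, 'a) mpoly = "('v \<Rightarrow>\<^sub>0 nat) \<Rightarrow>\<^sub>0 'a"

definition mpoly_vars :: "('v, 'a :: zero) mpoly \<Rightarrow> 'v set" where
  "mpoly_vars p = (\<Union>m\<in>Poly_Mapping.keys p. Poly_Mapping.keys m)"

definition total_degree :: "('v, 'a :: zero) mpoly \<Rightarrow> nat" where
  "total_degree p = Max (insert 0 (mdeg ` Poly_Mapping.keys p))"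

definition homogeneous :: "('v, 'a :: zero) mpoly \<Rightarrow> bool" where
  "homogeneous p \<longleftrightarrow> (\<exists>d. \<forall>m\<in>Poly_Mapping.keys p. mdeg m = d)"

definition eval_int_mpoly :: "('v \<Rightarrow> 'a :: comm_ring_1) \<Rightarrow> ('v, int) mpoly \<Rightarrow> 'a" where
  "eval_int_mpoly c p = (\<Sum>m\<in>Poly_Mapping.keys p.
     of_int (Poly_Mapping.lookup p m) * (\<Prod>v\<in>Poly_Mapping.keys m. c v ^ Poly_Mapping.lookup m v))"

definition mseries_of_mpoly :: "(nat, 'a :: zero) mpoly \<Rightarrow> 'a mseries" where
  "mseries_of_mpoly p = Abs_mseries (Poly_Mapping.lookup p)"

text \<open>The ring of polynomials in \<open>x\<close> and \<open>y\<close> is rendered as that of polynomials in \<open>y\<close> over those in \<open>x\<close>.\<close>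

definition poly_with_support ::
    "(mindex \<times> nat) set \<Rightarrow> (mindex \<times> nat \<Rightarrow> 'a :: comm_ring_1) \<Rightarrow> (nat, 'a) mpoly poly" where
  "poly_with_support S a = (\<Sum>(i, j)\<in>S. monom (Poly_Mapping.single i (a (i, j))) j)"

definition vanishes_at :: "(nat, 'a :: comm_ring_1) mpoly poly \<Rightarrow> 'a mseries \<Rightarrow> bool" where
  "vanishes_at P y \<longleftrightarrow> poly (map_poly mseries_of_mpoly P) y = 0"

definition algebraic_rel ::
    "(mindex \<times> nat) list \<Rightarrow> (mindex \<times> nat) list \<Rightarrow> 'a :: comm_ring_1 mseries \<Rightarrow> bool" where
  "algebraic_rel F G y \<longleftrightarrow>
     (\<exists>a. poly_with_support (set F \<union> set G) a \<noteq> 0 \<and>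
          vanishes_at (poly_with_support (set F \<union> set G) a) y)"

end

theory Submission
  imports Defs "Jordan_Normal_Form.Determinant"
begin

text \<open>
  A polynomial supported in \<open>F \<union> G\<close> that vanishes at \<open>y\<^sub>0\<close> is a linear relation between the series
  \<open>x\<^sup>i y\<^sub>0\<^sup>j\<close>. If one exists, then any \<open>Q\<close> with this support such that \<open>Q(x, y\<^sub>0)\<close> has order greater
  than \<open>2 * dx * dy\<close> already vanishes at \<open>y\<^sub>0\<close>, by a resultant argument, so the relations are the
  kernel of the finite matrix of the coefficients of degree at most \<open>N\<close>. Its entry in row \<open>n\<close> and
  column \<open>(i, j)\<close> is the value of an integer polynomial, homogeneous of degree \<open>j\<close>, in the
  coefficients of \<open>y\<^sub>0\<close>. Adding one column to a nonvanishing minor of maximal size, the cofactors of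
  that column set form a nonzero kernel vector; the finitely many choices of rows and columns are
  indexed by \<open>\<Lambda>\<close>. The cofactor of \<open>(i, j)\<close> does not involve the column \<open>(i, j)\<close>, which gives the
  \<open>-1\<close> in the degree bound on \<open>F\<close>; on \<open>G\<close> it is compensated by \<open>mdeg i > 0\<close>.
\<close>

subsection \<open>Monomials and series\<close>

lemma mdeg_superset:
  assumes "finite A" "Poly_Mapping.keys n \<subseteq> A"
  shows "mdeg n = (\<Sum>v\<in>A. Poly_Mapping.lookup n v)"
  unfolding mdeg_def using assms
  by (intro sum.mono_neutral_left) (auto simp: in_keys_iff)

lemma mdeg_add: "mdeg (m + n) = mdeg m + mdeg n"
proof -
  let ?A = "Poly_Mapping.keys m \<union> Poly_Mapping.keys n"
  have "Poly_Mapping.keys (m + n) \<subseteq> ?A"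
    by (rule keys_add)
  thus ?thesis
    using mdeg_superset[of ?A "m + n"] mdeg_superset[of ?A m] mdeg_superset[of ?A n]
    by (simp add: lookup_add sum.distrib)
qed

lemma mdeg_zero [simp]: "mdeg 0 = 0"
  by (simp add: mdeg_def)

lemma mdeg_single [simp]: "mdeg (Poly_Mapping.single v k) = k"
  by (simp add: mdeg_def)

lemma mdeg_eq_0_iff [simp]: "mdeg n = 0 \<longleftrightarrow> n = 0"
proof
  assume "mdeg n = 0"
  hence "\<forall>v\<in>Poly_Mapping.keys n. Poly_Mapping.lookup n v = 0"
    by (simp add: mdeg_def)
  thus "n = 0"
    by (metis in_keys_iff lookup_zero poly_mapping_eqI)
qed simp

lemma lookup_le_mdeg: "Poly_Mapping.lookup n v \<le> mdeg n"
proof (cases "v \<in> Poly_Mapping.keys n")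
  case True
  thus ?thesis unfolding mdeg_def by (intro member_le_sum) auto
qed (simp add: in_keys_iff)

lemma keys_add_nat:
  fixes m n :: "'v \<Rightarrow>\<^sub>0 nat"
  shows "Poly_Mapping.keys (m + n) = Poly_Mapping.keys m \<union> Poly_Mapping.keys n"
  by (auto simp: in_keys_iff lookup_add)

lemma mindices_add_iff: "m + n \<in> mindices r \<longleftrightarrow> m \<in> mindices r \<and> n \<in> mindices r"
  by (auto simp: mindices_def keys_add_nat)

lemma mindices_0 [simp]: "0 \<in> mindices r"
  by (simp add: mindices_def)

lemma finite_mdeg_le:
  assumes "finite V"
  shows "finite {n :: 'v \<Rightarrow>\<^sub>0 nat. Poly_Mapping.keys n \<subseteq> V \<and> mdeg n \<le> d}" (is "finite ?A")
proof -
  let ?S = "{f :: 'v \<Rightarrow> nat. \<forall>v. (v \<in> V \<longrightarrow> f v \<in> {..d}) \<and> (v \<notin> V \<longrightarrow> f v = 0)}"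
  have "Poly_Mapping.lookup ` ?A \<subseteq> ?S"
    by (force simp: in_keys_iff intro: order_trans[OF lookup_le_mdeg])
  moreover have "finite ?S"
    using assms by (intro finite_set_of_finite_funs) auto
  ultimately have "finite (Poly_Mapping.lookup ` ?A)"
    by (rule finite_subset)
  thus ?thesis
    by (rule finite_imageD) (simp add: inj_on_def lookup_inject)
qed

text \<open>Prefixing the slack \<open>d - mdeg n\<close> turns an exponent into a list of
  \<open>r + 1\<close> naturals with sum \<open>d\<close>, and such lists are counted by stars and
  bars. Injectivity gives the inequality.\<close>

lemma card_mdeg_le: "card {n \<in> mindices r. mdeg n \<le> d} \<le> (d + r) choose r"
proof -
  let ?A = "{n \<in> mindices r. mdeg n \<le> d}"
  let ?L = "{l :: nat list. length l = Suc r \<and> sum_list l = d}"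
  let ?f = "\<lambda>n. (d - mdeg n) # map (Poly_Mapping.lookup n) [1..<Suc r]"
  have "?f ` ?A \<subseteq> ?L"
  proof
    fix l assume "l \<in> ?f ` ?A"
    then obtain n where n: "n \<in> ?A" "l = ?f n" by blast
    have "mdeg n = (\<Sum>v\<in>{1..r}. Poly_Mapping.lookup n v)"
      using n by (intro mdeg_superset) (auto simp: mindices_def)
    also have "\<dots> = sum_list (map (Poly_Mapping.lookup n) [1..<Suc r])"
      by (simp only: interv_sum_list_conv_sum_set_nat set_upt atLeastLessThanSuc_atLeastAtMost)
    finally show "l \<in> ?L" using n by simp
  qed
  moreover have "inj_on ?f ?A"
  proof (rule inj_onI)
    fix m n assume m: "m \<in> ?A" and n: "n \<in> ?A" and eq: "?f m = ?f n"
    hence "\<forall>v\<in>set [1..<Suc r]. Poly_Mapping.lookup m v = Poly_Mapping.lookup n v"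
      by (auto simp del: upt_Suc)
    moreover have "Poly_Mapping.lookup m v = 0" "Poly_Mapping.lookup n v = 0"
      if "v \<notin> set [1..<Suc r]" for v
      using that m n by (auto simp: mindices_def in_keys_iff subset_iff simp del: upt_Suc)
    ultimately show "m = n"
      by (metis poly_mapping_eqI)
  qed
  moreover have "finite ?L"
    by (rule finite_subset[OF _ finite_lists_length_eq[of "{..d}" "Suc r"]])
       (auto dest: member_le_sum_list)
  ultimately have "card ?A \<le> card ?L"
    by (intro card_inj_on_le)
  also have "\<dots> = (d + r) choose d"
    by (simp add: card_length_sum_list)
  also have "\<dots> = (d + r) choose r"
    by (subst binomial_symmetric) auto
  finally show ?thesis .
qed

lemma scoeff_mult:
  "scoeff (f * g) n = (\<Sum>(a, b)\<in>{(a, b). a + b = n}. scoeff f a * scoeff g b)"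
  by (simp add: times_mseries.rep_eq)

lemma scoeff_sum: "scoeff (sum f A) n = (\<Sum>x\<in>A. scoeff (f x) n)"
  by (induction A rule: infinite_finite_induct)
     (auto simp: zero_mseries.rep_eq plus_mseries.rep_eq)

lemma scoeff_mseries_of_mpoly: "scoeff (mseries_of_mpoly p) = Poly_Mapping.lookup p"
  by (simp add: mseries_of_mpoly_def Abs_mseries_inverse)

lemma scoeff_monomial:
  "scoeff (mseries_of_mpoly (Poly_Mapping.single i a)) n = (if n = i then a else 0)"
  by (simp add: scoeff_mseries_of_mpoly lookup_single when_def)

text \<open>Separates the unknown coefficient \<open>a\<close> from the matrix entry, which depends
  only on \<open>i\<close>, \<open>n\<close> and \<open>f\<close>.\<close>

lemma scoeff_monomial_mult:
  "scoeff (mseries_of_mpoly (Poly_Mapping.single i a) * f) n =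
     a * scoeff (mseries_of_mpoly (Poly_Mapping.single i 1) * f) n"
  by (simp add: scoeff_mult scoeff_monomial sum_distrib_left)
     (intro sum.cong refl, auto)

text \<open>Restricting to the finitely many variables below a bound makes the support in each degree
  finite, so that a nonzero series has a leading exponent for the graded lexicographic order.\<close>

lemma leading_exponent_exists:
  fixes f :: "'a :: comm_ring_1 mseries"
  assumes "scoeff f n \<noteq> 0" "Poly_Mapping.keys n \<subseteq> V" "finite V"
  obtains n0 where "scoeff f n0 \<noteq> 0" "Poly_Mapping.keys n0 \<subseteq> V"
    "\<And>m. scoeff f m \<noteq> 0 \<Longrightarrow> Poly_Mapping.keys m \<subseteq> V \<Longrightarrow> grlex_le n0 m"
proof -
  define S where "S = {m. scoeff f m \<noteq> 0 \<and> Poly_Mapping.keys m \<subseteq> V}"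
  define d where "d = (LEAST d. d \<in> mdeg ` S)"
  have "n \<in> S" using assms by (simp add: S_def)
  hence d: "d \<in> mdeg ` S" and dle: "\<And>m. m \<in> S \<Longrightarrow> d \<le> mdeg m"
    unfolding d_def by (auto intro: LeastI Least_le)
  let ?T = "{m \<in> S. mdeg m = d}"
  have "finite ?T"
    by (rule finite_subset[OF _ finite_mdeg_le[OF assms(3), of d]]) (auto simp: S_def)
  moreover have "?T \<noteq> {}" using d by auto
  ultimately have M: "Min ?T \<in> ?T" by (rule Min_in)
  have Mle: "Min ?T \<le> m" if "m \<in> ?T" for m
    using \<open>finite ?T\<close> that by (rule Min_le)
  show thesis
  proof (rule that[of "Min ?T"])
    show "scoeff f (Min ?T) \<noteq> 0" "Poly_Mapping.keys (Min ?T) \<subseteq> V"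
      using M by (auto simp: S_def)
    fix m assume "scoeff f m \<noteq> 0" "Poly_Mapping.keys m \<subseteq> V"
    hence "m \<in> S" by (simp add: S_def)
    thus "grlex_le (Min ?T) m"
      using M dle[of m] Mle[of m] by (auto simp: grlex_le_def)
  qed
qed

text \<open>Degrees add, so equal sums force equal degrees, and the lexicographic order is
  compatible with addition. Hence the product of two leading terms meets no other term.\<close>

lemma grlex_le_add_eq:
  assumes "grlex_le a0 a" "grlex_le b0 b" "a + b = a0 + b0"
  shows "a = a0 \<and> b = b0"
proof -
  have "mdeg a + mdeg b = mdeg a0 + mdeg b0"
    using assms(3) by (metis mdeg_add)
  hence "a0 \<le> a" "b0 \<le> b"
    using assms by (auto simp: grlex_le_def)
  thus ?thesis
    using assms(3) by (metis add_le_cancel_left add_le_cancel_right add_mono antisym order_refl)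
qed

instance mseries :: (idom) idom
proof
  fix f g :: "'a mseries"
  assume "f \<noteq> 0" "g \<noteq> 0"
  then obtain n m where nm: "scoeff f n \<noteq> 0" "scoeff g m \<noteq> 0"
    by (auto simp: mseries_eq_iff zero_mseries.rep_eq)
  \<comment> \<open>With infinitely many variables a nonzero series need not have a least exponent:
    the sum of all variables has none. A finite set \<open>V\<close> carrying one nonzero
    coefficient of each factor suffices, since the splittings of \<open>n0 + m0\<close> stay inside
    \<open>V\<close>.\<close>
  define V where "V = Poly_Mapping.keys n \<union> Poly_Mapping.keys m"
  have V: "finite V" "Poly_Mapping.keys n \<subseteq> V" "Poly_Mapping.keys m \<subseteq> V"
    by (auto simp: V_def)
  obtain n0 where n0: "scoeff f n0 \<noteq> 0" "Poly_Mapping.keys n0 \<subseteq> V"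
    "\<And>m. scoeff f m \<noteq> 0 \<Longrightarrow> Poly_Mapping.keys m \<subseteq> V \<Longrightarrow> grlex_le n0 m"
    using leading_exponent_exists[OF nm(1) V(2,1)] by metis
  obtain m0 where m0: "scoeff g m0 \<noteq> 0" "Poly_Mapping.keys m0 \<subseteq> V"
    "\<And>m. scoeff g m \<noteq> 0 \<Longrightarrow> Poly_Mapping.keys m \<subseteq> V \<Longrightarrow> grlex_le m0 m"
    using leading_exponent_exists[OF nm(2) V(3,1)] by metis
  have "scoeff f a * scoeff g b = 0" if "a + b = n0 + m0" "(a, b) \<noteq> (n0, m0)" for a b
  proof (rule ccontr)
    assume "scoeff f a * scoeff g b \<noteq> 0"
    moreover have "Poly_Mapping.keys a \<union> Poly_Mapping.keys b \<subseteq> V"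
      using that(1) n0(2) m0(2) by (metis keys_add_nat Un_least)
    ultimately have "grlex_le n0 a" "grlex_le m0 b"
      using n0(3) m0(3) by auto
    thus False using grlex_le_add_eq that by blast
  qed
  hence "scoeff (f * g) (n0 + m0) = (\<Sum>(a, b)\<in>{(n0, m0)}. scoeff f a * scoeff g b)"
    unfolding scoeff_mult
    by (intro sum.mono_neutral_right finite_mindex_splits) (auto simp del: mult_eq_0_iff)
  hence "scoeff (f * g) (n0 + m0) \<noteq> 0" using n0(1) m0(1) by simp
  thus "f * g \<noteq> 0" by (auto simp: zero_mseries.rep_eq)
qed

section \<open>Order and degree of a series\<close>

definition order_ge :: "nat \<Rightarrow> 'a :: zero mseries \<Rightarrow> bool" where
  "order_ge d f \<longleftrightarrow> (\<forall>n. mdeg n < d \<longrightarrow> scoeff f n = 0)"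

lemma order_ge_mult_left:
  fixes f g :: "'a :: comm_ring_1 mseries"
  assumes "order_ge d f"
  shows "order_ge d (f * g)"
  unfolding order_ge_def scoeff_mult
proof (intro allI impI sum.neutral ballI)
  fix n and x :: "mindex \<times> mindex" assume "mdeg n < d" "x \<in> {(a, b). a + b = n}"
  hence "mdeg (fst x) < d" by (auto simp: mdeg_add)
  thus "(case x of (a, b) \<Rightarrow> scoeff f a * scoeff g b) = 0"
    using assms by (simp add: order_ge_def case_prod_beta)
qed

lemma order_ge_minus: "order_ge d f \<Longrightarrow> order_ge d (- f)"
  by (simp add: order_ge_def uminus_mseries.rep_eq)

text \<open>Takes the place of being a polynomial: the degree is bounded, but the support may be
  infinite.\<close>

definition deg_le :: "nat \<Rightarrow> 'a :: zero mseries \<Rightarrow> bool" where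
  "deg_le d f \<longleftrightarrow> (\<forall>n. scoeff f n \<noteq> 0 \<longrightarrow> mdeg n \<le> d)"

lemma deg_le_0 [simp]: "deg_le d 0"
  by (simp add: deg_le_def zero_mseries.rep_eq)

lemma deg_le_1 [simp]: "deg_le d 1"
  by (simp add: deg_le_def one_mseries.rep_eq)

lemma deg_le_add: "deg_le d f \<Longrightarrow> deg_le d g \<Longrightarrow> deg_le d (f + g)"
  unfolding deg_le_def plus_mseries.rep_eq by (metis add.right_neutral)

lemma deg_le_minus: "deg_le d f \<Longrightarrow> deg_le d (- f)"
  by (simp add: deg_le_def uminus_mseries.rep_eq)

lemma deg_le_sum: "(\<And>x. x \<in> A \<Longrightarrow> deg_le d (f x)) \<Longrightarrow> deg_le d (sum f A)"
  by (induction A rule: infinite_finite_induct) (auto intro: deg_le_add)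

lemma deg_le_mono: "deg_le d f \<Longrightarrow> d \<le> e \<Longrightarrow> deg_le e f"
  by (auto simp: deg_le_def)

lemma deg_le_mult:
  fixes f g :: "'a :: comm_ring_1 mseries"
  assumes "deg_le d f" "deg_le e g"
  shows "deg_le (d + e) (f * g)"
  unfolding deg_le_def
proof (intro allI impI)
  fix n assume "scoeff (f * g) n \<noteq> 0"
  then obtain a b where "a + b = n" "scoeff f a * scoeff g b \<noteq> 0"
    unfolding scoeff_mult by (elim sum.not_neutral_contains_not_neutral) auto
  moreover from this have "mdeg a \<le> d" "mdeg b \<le> e"
    using assms unfolding deg_le_def by (metis mult_zero_left, metis mult_zero_right)
  ultimately show "mdeg n \<le> d + e" by (auto simp: mdeg_add)
qed

lemma deg_le_order_ge_imp_0: "deg_le d f \<Longrightarrow> order_ge (Suc d) f \<Longrightarrow> f = 0"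
  by (auto simp: deg_le_def order_ge_def mseries_eq_iff zero_mseries.rep_eq less_Suc_eq_le)

subsection \<open>Order of vanishing of a polynomial at an algebraic series\<close>

text \<open>\<open>a\<close> and \<open>b\<close> are only bounds on the degrees, so both sides may
  be zero. In this form the rule iterates over products even in the presence of zero
  divisors.\<close>

lemma coeff_mult_degree_le:
  fixes p q :: "'a :: comm_ring_1 poly"
  assumes "degree p \<le> a" "degree q \<le> b"
  shows "coeff (p * q) (a + b) = coeff p a * coeff q b"
proof -
  have "coeff (p * q) (a + b) = (\<Sum>i\<le>a + b. coeff p i * coeff q (a + b - i))"
    by (simp add: coeff_mult)
  also have "\<dots> = (\<Sum>i\<in>{a}. coeff p i * coeff q (a + b - i))"
  proof (rule sum.mono_neutral_right)
    show "\<forall>i\<in>{..a + b} - {a}. coeff p i * coeff q (a + b - i) = 0"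
    proof
      fix i assume "i \<in> {..a + b} - {a}"
      hence "i > a \<or> a + b - i > b" by auto
      thus "coeff p i * coeff q (a + b - i) = 0"
        using assms by (auto simp: coeff_eq_0)
    qed
  qed auto
  finally show ?thesis by simp
qed

lemma degree_prod_le:
  fixes f :: "'i \<Rightarrow> 'a :: comm_ring_1 poly"
  assumes "\<And>i. i \<in> I \<Longrightarrow> degree (f i) \<le> d i"
  shows "degree (prod f I) \<le> sum d I"
  using assms
proof (induction I rule: infinite_finite_induct)
  case (insert i I)
  have "degree (f i * prod f I) \<le> degree (f i) + degree (prod f I)"
    by (rule degree_mult_le)
  also have "\<dots> \<le> d i + sum d I"
    using insert by (intro add_mono) auto
  finally show ?case using insert by simp
qed auto

lemma coeff_prod_degree_le:
  fixes f :: "'i \<Rightarrow> 'a :: comm_ring_1 poly"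
  assumes "\<And>i. i \<in> I \<Longrightarrow> degree (f i) \<le> d i"
  shows "coeff (prod f I) (sum d I) = (\<Prod>i\<in>I. coeff (f i) (d i))"
  using assms
  by (induction I rule: infinite_finite_induct)
     (auto simp: coeff_mult_degree_le degree_prod_le)

text \<open>The \<open>m\<close>-th coefficient needs all linear factors of the first \<open>m\<close> rows, which forces a
  permutation to fix those rows; triangularity of the others then leaves only the identity.\<close>

lemma coeff_det_linear_diagonal:
  fixes A :: "'a :: comm_ring_1 poly mat"
  assumes A: "A \<in> carrier_mat (m + q) (m + q)"
    and lin: "\<And>i. i < m \<Longrightarrow> degree (A $$ (i, i)) \<le> 1"
    and const: "\<And>i l. i < m + q \<Longrightarrow> l < m + q \<Longrightarrow> \<not> (i < m \<and> l = i) \<Longrightarrow> degree (A $$ (i, l)) = 0"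
    and tri: "\<And>i l. m \<le> i \<Longrightarrow> i < l \<Longrightarrow> l < m + q \<Longrightarrow> A $$ (i, l) = 0"
  shows "coeff (det A) m =
    (\<Prod>i = 0..<m + q. coeff (A $$ (i, i)) (if i < m then 1 else 0))"
proof -
  let ?n = "m + q"
  let ?S = "{p. p permutes {0..<?n}}"
  let ?d = "\<lambda>p i. if i < m \<and> p i = i then 1 else (0 :: nat)"
  have deg: "degree (A $$ (i, p i)) \<le> ?d p i" if "p permutes {0..<?n}" "i \<in> {0..<?n}" for p i
  proof -
    have "p i < ?n" using permutes_in_image[OF that(1), of i] that(2) by simp
    thus ?thesis using lin[of i] const[of i "p i"] that(2) by (cases "i < m \<and> p i = i") auto
  qed
  have zero: "coeff (\<Prod>i = 0..<?n. A $$ (i, p i)) m = 0"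
    if p: "p permutes {0..<?n}" and "p \<noteq> id" for p
  proof -
    \<comment> \<open>Only the identity moves no index to the right. A lower row moved to the right
      meets a zero entry; an upper row moved off the diagonal gives a constant factor, so that the
      degree of the product drops below \<open>m\<close>.\<close>
    have "\<not> (\<forall>i\<in>{0..<?n}. p i \<le> i)"
      using permutes_natset_le[OF p] that(2) by blast
    then obtain i where i: "i < ?n" "i < p i" by auto
    have pi: "p i < ?n" using permutes_in_image[OF p, of i] i by simp
    show ?thesis
    proof (cases "i < m")
      case False
      hence "(\<Prod>i = 0..<?n. A $$ (i, p i)) = 0"
        using i pi tri[of i "p i"] by (intro prod_zero) auto
      thus ?thesis by simp
    next
      case True
      have "degree (\<Prod>i = 0..<?n. A $$ (i, p i)) \<le> sum (?d p) {0..<?n}"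
        using deg[OF p] by (rule degree_prod_le)
      also have "\<dots> = sum (?d p) {0..<m}"
        by (rule sum.mono_neutral_right) auto
      also have "\<dots> < (\<Sum>i = 0..<m. 1)"
        using True i by (intro sum_strict_mono_ex1) (auto intro!: bexI[of _ i])
      finally show ?thesis by (simp add: coeff_eq_0)
    qed
  qed
  have "coeff (det A) m = (\<Sum>p\<in>?S. coeff (signof p * (\<Prod>i = 0..<?n. A $$ (i, p i))) m)"
    unfolding det_def'[OF A] by (rule coeff_sum)
  also have "\<dots> = (\<Sum>p\<in>{id}. coeff (signof p * (\<Prod>i = 0..<?n. A $$ (i, p i))) m)"
  proof (rule sum.mono_neutral_right)
    show "\<forall>p\<in>?S - {id}. coeff (signof p * (\<Prod>i = 0..<?n. A $$ (i, p i))) m = 0"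
    proof
      fix p assume "p \<in> ?S - {id}"
      hence "coeff (\<Prod>i = 0..<?n. A $$ (i, p i)) m = 0"
        by (intro zero) auto
      thus "coeff (signof p * (\<Prod>i = 0..<?n. A $$ (i, p i))) m = 0"
        by (cases "sign p = 1") (simp_all add: sign_def split: if_splits)
    qed
  qed (auto simp: finite_permutations permutes_id)
  also have "\<dots> = coeff (\<Prod>i = 0..<?n. A $$ (i, i)) m"
    by simp
  also have "\<dots> = coeff (\<Prod>i = 0..<?n. A $$ (i, i)) (sum (?d id) {0..<?n})"
  proof -
    have "sum (?d id) {0..<?n} = sum (?d id) {0..<m}"
      by (rule sum.mono_neutral_right) auto
    thus ?thesis by simp
  qed
  also have "\<dots> = (\<Prod>i = 0..<?n. coeff (A $$ (i, i)) (?d id i))"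
    using deg[OF permutes_id] by (intro coeff_prod_degree_le) auto
  finally show ?thesis by simp
qed

section \<open>Degrees of the coefficients of a determinant\<close>

definition coeffs_deg_le :: "nat \<Rightarrow> 'a :: comm_ring_1 mseries poly \<Rightarrow> bool" where
  "coeffs_deg_le d p \<longleftrightarrow> (\<forall>k. deg_le d (coeff p k))"

lemma coeffs_deg_le_mult:
  fixes p q :: "'a :: comm_ring_1 mseries poly"
  assumes "coeffs_deg_le d p" "coeffs_deg_le e q"
  shows "coeffs_deg_le (d + e) (p * q)"
  using assms by (auto simp: coeffs_deg_le_def coeff_mult intro!: deg_le_sum deg_le_mult)

lemma coeffs_deg_le_prod:
  fixes f :: "'i \<Rightarrow> 'a :: comm_ring_1 mseries poly"
  assumes "\<And>i. i \<in> I \<Longrightarrow> coeffs_deg_le d (f i)"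
  shows "coeffs_deg_le (card I * d) (prod f I)"
  using assms
proof (induction I rule: infinite_finite_induct)
  case (insert i I)
  thus ?case using coeffs_deg_le_mult[of d "f i" "card I * d" "prod f I"] by simp
qed (auto simp: coeffs_deg_le_def coeff_1)

text \<open>Each term of the Leibniz expansion is, up to sign, a product of \<open>n\<close>
  entries.\<close>

lemma coeffs_deg_le_det:
  fixes A :: "'a :: comm_ring_1 mseries poly mat"
  assumes A: "A \<in> carrier_mat n n"
    and "\<And>i j. i < n \<Longrightarrow> j < n \<Longrightarrow> coeffs_deg_le d (A $$ (i, j))"
  shows "coeffs_deg_le (n * d) (det A)"
proof -
  have "coeffs_deg_le (card {0..<n} * d) (\<Prod>i = 0..<n. A $$ (i, p i))"
    if "p permutes {0..<n}" for p
    using that assms(2) permutes_in_image[OF that] by (intro coeffs_deg_le_prod) auto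
  thus ?thesis
    unfolding det_def'[OF A] coeffs_deg_le_def coeff_sum
    by (auto intro!: deg_le_sum simp: sign_def deg_le_minus)
qed

lemma poly_eq_sum_lessThan:
  fixes p :: "'a :: comm_ring_1 poly"
  assumes "degree p < n"
  shows "poly p x = (\<Sum>l<n. coeff p l * x ^ l)"
  unfolding poly_altdef using assms
  by (intro sum.mono_neutral_left) (auto simp: coeff_eq_0)

text \<open>The series \<open>z = Q(y)\<close> is a root of the resultant of \<open>P\<close> and \<open>Q - T\<close> with respect to the
  variable of \<open>P\<close> and \<open>Q\<close>, whose coefficients have degree at most \<open>2 * dx * dy\<close>. As \<open>T\<close> occurs in
  it with exponent \<open>degree P\<close>, it is nonzero without any coprimality assumption, and its lowest
  nonzero coefficient is divisible by \<open>z\<close> unless \<open>z = 0\<close>.\<close>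

lemma poly_eq_0_of_order_ge:
  fixes P Q :: "'a :: idom mseries poly"
  assumes P: "P \<noteq> 0" "degree P \<le> dy" "coeffs_deg_le dx P" "poly P y = 0"
    and Q: "degree Q \<le> dy" "coeffs_deg_le dx Q"
    and ord: "order_ge (Suc (2 * dx * dy)) (poly Q y)"
  shows "poly Q y = 0"
proof (rule ccontr)
  define m where "m = degree P"
  define z where "z = poly Q y"
  assume "poly Q y \<noteq> 0"
  hence z: "z \<noteq> 0" by (simp add: z_def)
  \<comment> \<open>A constant polynomial with a root is zero.\<close>
  have m: "0 < m"
  proof (rule ccontr)
    assume "\<not> 0 < m"
    then obtain c where "P = [:c:]" unfolding m_def by (auto elim: degree_eq_zeroE)
    thus False using P by simp
  qed
  let ?n = "m + dy"
  \<comment> \<open>The Sylvester matrix. With \<open>Y\<close> the common variable of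
    \<open>P\<close> and \<open>Q\<close> and \<open>T\<close> standing for \<open>[:0, 1:]\<close>,
    its rows are \<open>Y^i * (Q - T)\<close> for \<open>i < m\<close>, then
    \<open>Y^(i - m) * P\<close>; its columns are the powers of \<open>Y\<close>. \<open>Q\<close>
    is treated as having degree \<open>dy\<close>.\<close>
  define A where "A = mat ?n ?n (\<lambda>(i, l). if i < m
    then [:coeff (monom 1 i * Q) l:] - (if l = i then [:0, 1:] else 0)
    else [:coeff (monom 1 (i - m) * P) l:])"
  have A: "A \<in> carrier_mat ?n ?n" by (simp add: A_def)
  define R where "R = det A"
  interpret ev: comm_ring_hom "\<lambda>p. poly p z"
    by unfold_locales auto
  \<comment> \<open>At \<open>T = z\<close> every row annihilates the vector of powers of
    \<open>y\<close>, because \<open>Q(y) = z\<close> and \<open>P(y) = 0\<close>. The entry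
    \<open>y ^ 0 = 1\<close> makes this vector nonzero.\<close>
  have "poly R z = 0"
  proof -
    let ?B = "map_mat (\<lambda>p. poly p z) A"
    define v where "v = vec ?n (\<lambda>l. y ^ l)"
    have B: "?B \<in> carrier_mat ?n ?n" using A by simp
    have v: "v \<in> carrier_vec ?n" by (simp add: v_def)
    have "v $ 0 = 1" using m by (simp add: v_def)
    hence "v \<noteq> 0\<^sub>v ?n" using m by auto
    moreover have "?B *\<^sub>v v = 0\<^sub>v ?n"
    proof (rule eq_vecI)
      fix i assume "i < dim_vec (0\<^sub>v ?n :: 'a mseries vec)"
      hence i: "i < ?n" by simp
      have *: "(?B *\<^sub>v v) $ i = (\<Sum>l<?n. poly (A $$ (i, l)) z * y ^ l)"
        using A i by (simp add: scalar_prod_def v_def atLeast0LessThan)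
      show "(?B *\<^sub>v v) $ i = 0\<^sub>v ?n $ i"
      proof (cases "i < m")
        case True
        have "degree (monom 1 i * Q) \<le> i + dy"
          using degree_mult_le[of "monom 1 i" Q] degree_monom_le[of "1 :: 'a mseries" i] Q(1) by linarith
        hence d: "degree (monom 1 i * Q) < ?n" using True by simp
        have "(\<Sum>l<?n. poly (A $$ (i, l)) z * y ^ l) =
          (\<Sum>l<?n. coeff (monom 1 i * Q) l * y ^ l - (if l = i then z * y ^ i else 0))"
          using True by (intro sum.cong) (auto simp: A_def algebra_simps)
        also have "\<dots> = poly (monom 1 i * Q) y - z * y ^ i"
          using i by (simp add: sum_subtractf poly_eq_sum_lessThan[OF d, symmetric] del: poly_mult)
        also have "\<dots> = 0" by (simp add: poly_monom z_def)
        finally show ?thesis using * i by simp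
      next
        case False
        have "degree (monom 1 (i - m) * P) \<le> (i - m) + m"
          using degree_mult_le[of "monom 1 (i - m)" P] degree_monom_le[of "1 :: 'a mseries" "i - m"]
          unfolding m_def by linarith
        hence d: "degree (monom 1 (i - m) * P) < ?n" using False i by simp
        have "(\<Sum>l<?n. poly (A $$ (i, l)) z * y ^ l) = (\<Sum>l<?n. coeff (monom 1 (i - m) * P) l * y ^ l)"
          using False i by (intro sum.cong) (auto simp: A_def)
        also have "\<dots> = poly (monom 1 (i - m) * P) y"
          by (simp only: poly_eq_sum_lessThan[OF d])
        also have "\<dots> = 0" by (simp add: P(4))
        finally show ?thesis using * i by simp
      qed
    qed (use A in simp)
    ultimately have "det ?B = 0"
      using det_0_iff_vec_prod_zero[OF B] v by blast
    thus ?thesis by (simp add: R_def)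
  qed
  \<comment> \<open>Every entry has degree at most \<open>dx\<close> in \<open>x\<close>, the
    constant \<open>-1\<close> at \<open>T\<close> included, and the size \<open>m + dy\<close> is
    at most \<open>2 * dy\<close>.\<close>
  have "coeffs_deg_le (2 * dx * dy) R"
  proof -
    have e: "coeffs_deg_le dx (A $$ (i, j))" if "i < ?n" "j < ?n" for i j
      unfolding coeffs_deg_le_def
    proof
      fix k
      have c: "deg_le dx (coeff (monom 1 i' * P) l)" "deg_le dx (coeff (monom 1 i' * Q) l)" for i' l
        using P(3) Q(2) by (auto simp: coeff_monom_mult coeffs_deg_le_def)
      have "deg_le dx (coeff [:g:] k)" "deg_le dx (coeff [:g, - 1:] k)" if "deg_le dx g" for g :: "'a mseries"
        using that by (simp_all add: coeff_pCons deg_le_minus split: nat.split)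
      thus "deg_le dx (coeff (A $$ (i, j)) k)"
        using that c by (simp add: A_def del: coeff_diff)
    qed
    have "coeffs_deg_le (?n * dx) R"
      unfolding R_def using A e by (rule coeffs_deg_le_det)
    moreover have "?n * dx \<le> 2 * dx * dy" using P(2) by (simp add: m_def)
    ultimately show ?thesis by (auto simp: coeffs_deg_le_def intro: deg_le_mono)
  qed
  \<comment> \<open>The diagonal contributes \<open>-1\<close> from each of the first
    \<open>m\<close> rows and the leading coefficient of \<open>P\<close> from each of the
    others.\<close>
  have "coeff R m \<noteq> 0"
  proof -
    have "coeff R m = (\<Prod>i = 0..<?n. coeff (A $$ (i, i)) (if i < m then 1 else 0))"
      unfolding R_def
    proof (rule coeff_det_linear_diagonal[OF A])
      fix i assume "i < m"
      thus "degree (A $$ (i, i)) \<le> 1"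
        by (simp add: A_def)
    next
      fix i l assume "i < ?n" "l < ?n" "\<not> (i < m \<and> l = i)"
      thus "degree (A $$ (i, l)) = 0"
        by (cases "i < m") (auto simp: A_def)
    next
      fix i l assume il: "m \<le> i" "i < l" "l < ?n"
      hence "coeff P (l - (i - m)) = 0"
        by (intro coeff_eq_0) (simp add: m_def)
      thus "A $$ (i, l) = 0"
        using il by (simp add: A_def coeff_monom_mult)
    qed
    moreover have "coeff (A $$ (i, i)) (if i < m then 1 else 0) \<noteq> 0" if "i < ?n" for i
    proof (cases "i < m")
      case True
      thus ?thesis using that by (simp add: A_def)
    next
      case False
      hence "i - (i - m) = m" by simp
      thus ?thesis using that False P(1) by (simp add: A_def coeff_monom_mult) (simp add: m_def)
    qed
    ultimately show ?thesis by simp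
  qed
  \<comment> \<open>Cancelling \<open>z ^ k\<close> in \<open>R(z) = 0\<close> writes the lowest
    coefficient as \<open>- (z * s)\<close>. Its order then exceeds \<open>2 * dx * dy\<close> while
    its degree does not, so it would be zero.\<close>
  define k where "k = (LEAST k. coeff R k \<noteq> 0)"
  have k: "coeff R k \<noteq> 0"
    unfolding k_def using \<open>coeff R m \<noteq> 0\<close> by (rule LeastI)
  have below: "coeff R l = 0" if "l < k" for l
    using that not_less_Least unfolding k_def by blast
  define s where "s = (\<Sum>l\<in>{k<..degree R}. coeff R l * z ^ (l - Suc k))"
  have "0 = (\<Sum>l\<le>degree R. coeff R l * z ^ l)"
    using \<open>poly R z = 0\<close> by (simp add: poly_altdef)
  also have "\<dots> = (\<Sum>l\<in>{k..degree R}. coeff R l * z ^ l)"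
    by (rule sum.mono_neutral_right) (auto simp: below)
  also have "{k..degree R} = insert k {k<..degree R}"
    using le_degree[OF k] by auto
  also have "(\<Sum>l\<in>\<dots>. coeff R l * z ^ l) = coeff R k * z ^ k + (\<Sum>l\<in>{k<..degree R}. coeff R l * z ^ l)"
    by simp
  also have "(\<Sum>l\<in>{k<..degree R}. coeff R l * z ^ l) = z ^ k * (z * s)"
    unfolding s_def sum_distrib_left
  proof (rule sum.cong[OF refl])
    fix l assume "l \<in> {k<..degree R}"
    hence "l = k + Suc (l - Suc k)" by simp
    hence "z ^ l = z ^ k * (z * z ^ (l - Suc k))" by (metis power_add power_Suc)
    thus "coeff R l * z ^ l = z ^ k * (z * (coeff R l * z ^ (l - Suc k)))" by (simp add: mult_ac)
  qed
  finally have "z ^ k * (coeff R k + z * s) = 0"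
    by (simp only: distrib_left mult.commute[of "coeff R k"])
  hence "coeff R k + z * s = 0"
    using z by simp
  hence "coeff R k = - (z * s)"
    by (simp only: eq_neg_iff_add_eq_0)
  moreover have "order_ge (Suc (2 * dx * dy)) (- (z * s))"
    using ord unfolding z_def by (intro order_ge_minus order_ge_mult_left)
  ultimately have "order_ge (Suc (2 * dx * dy)) (coeff R k)"
    by (simp only:)
  moreover have "deg_le (2 * dx * dy) (coeff R k)"
    using \<open>coeffs_deg_le (2 * dx * dy) R\<close> by (simp add: coeffs_deg_le_def)
  ultimately show False
    using k deg_le_order_ge_imp_0 by blast
qed

subsection \<open>Evaluation and homogeneity of integer polynomials\<close>

definition monomial_value :: "('v \<Rightarrow> 'a :: comm_ring_1) \<Rightarrow> ('v \<Rightarrow>\<^sub>0 nat) \<Rightarrow> 'a" where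
  "monomial_value c m = (\<Prod>v\<in>Poly_Mapping.keys m. c v ^ Poly_Mapping.lookup m v)"

lemma monomial_value_superset:
  assumes "finite A" "Poly_Mapping.keys m \<subseteq> A"
  shows "monomial_value c m = (\<Prod>v\<in>A. c v ^ Poly_Mapping.lookup m v)"
  unfolding monomial_value_def using assms
  by (intro prod.mono_neutral_left) (auto simp: in_keys_iff)

lemma monomial_value_add:
  "monomial_value c (m + n) = monomial_value c m * monomial_value c n"
proof -
  let ?A = "Poly_Mapping.keys m \<union> Poly_Mapping.keys n"
  show ?thesis
    using monomial_value_superset[of ?A m c] monomial_value_superset[of ?A n c]
      monomial_value_superset[of ?A "m + n" c]
    by (simp add: keys_add_nat lookup_add power_add prod.distrib)
qed

lemma eval_int_mpoly_superset:
  assumes "finite A" "Poly_Mapping.keys p \<subseteq> A"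
  shows "eval_int_mpoly c p = (\<Sum>m\<in>A. of_int (Poly_Mapping.lookup p m) * monomial_value c m)"
  unfolding eval_int_mpoly_def monomial_value_def using assms
  by (intro sum.mono_neutral_left) (auto simp: in_keys_iff)

lemma eval_int_mpoly_single [simp]:
  "eval_int_mpoly c (Poly_Mapping.single m a) = of_int a * monomial_value c m"
  by (subst eval_int_mpoly_superset[of "{m}"]) auto

lemma eval_int_mpoly_zero [simp]: "eval_int_mpoly c 0 = 0"
  by (simp add: eval_int_mpoly_def)

lemma eval_int_mpoly_add: "eval_int_mpoly c (p + q) = eval_int_mpoly c p + eval_int_mpoly c q"
proof -
  let ?A = "Poly_Mapping.keys p \<union> Poly_Mapping.keys q"
  show ?thesis
    using eval_int_mpoly_superset[of ?A p c] eval_int_mpoly_superset[of ?A q c]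
      eval_int_mpoly_superset[of ?A "p + q" c]
    by (simp add: keys_add lookup_add distrib_right sum.distrib)
qed

lemma eval_int_mpoly_sum: "eval_int_mpoly c (sum f A) = (\<Sum>x\<in>A. eval_int_mpoly c (f x))"
  by (induction A rule: infinite_finite_induct) (auto simp: eval_int_mpoly_add)

lemma poly_mapping_eq_sum_single:
  fixes p :: "'b \<Rightarrow>\<^sub>0 'a :: comm_monoid_add"
  shows "p = (\<Sum>m\<in>Poly_Mapping.keys p. Poly_Mapping.single m (Poly_Mapping.lookup p m))"
  by (rule poly_mapping_eqI)
     (auto simp: lookup_sum lookup_single when_def in_keys_iff if_distrib cong: if_cong)

lemma eval_int_mpoly_mult:
  fixes p q :: "('b, int) mpoly"
  shows "eval_int_mpoly c (p * q) = eval_int_mpoly c p * eval_int_mpoly c q"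
proof -
  \<comment> \<open>By bilinearity it is enough to compare both sides on single terms.\<close>
  define f where "f p m = Poly_Mapping.single m (Poly_Mapping.lookup p m)" for p :: "('b, int) mpoly" and m
  have f: "p = sum (f p) (Poly_Mapping.keys p)" for p :: "('b, int) mpoly"
    unfolding f_def by (rule poly_mapping_eq_sum_single)
  have "eval_int_mpoly c (f p m * f q n) = eval_int_mpoly c (f p m) * eval_int_mpoly c (f q n)" for m n
    by (simp add: f_def mult_single monomial_value_add)
  hence "eval_int_mpoly c (sum (f p) (Poly_Mapping.keys p) * sum (f q) (Poly_Mapping.keys q)) =
    eval_int_mpoly c (sum (f p) (Poly_Mapping.keys p)) * eval_int_mpoly c (sum (f q) (Poly_Mapping.keys q))"
    by (simp add: sum_product eval_int_mpoly_sum)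
  thus ?thesis using f by metis
qed

text \<open>Lets evaluation pass through determinants, so that minors of the generic matrix
  specialise to minors of the concrete one.\<close>

lemma comm_ring_hom_eval_int_mpoly: "comm_ring_hom (eval_int_mpoly c)"
proof
  show "eval_int_mpoly c 1 = 1"
    using eval_int_mpoly_single[of c 0 1] by (simp add: monomial_value_def)
qed (auto simp: eval_int_mpoly_add eval_int_mpoly_mult)

text \<open>The degree is an explicit parameter and the variables are recorded with it, so that both
  pass through sums, products and determinants together. The zero polynomial has every
  degree.\<close>

definition homogeneous_in :: "'v set \<Rightarrow> nat \<Rightarrow> ('v, 'a :: zero) mpoly \<Rightarrow> bool" where
  "homogeneous_in V d p \<longleftrightarrow> (\<forall>m\<in>Poly_Mapping.keys p. Poly_Mapping.keys m \<subseteq> V \<and> mdeg m = d)"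

lemma homogeneous_in_0 [simp]: "homogeneous_in V d 0"
  by (simp add: homogeneous_in_def)

lemma homogeneous_in_1 [simp]: "homogeneous_in V 0 (1 :: ('v, 'a :: comm_ring_1) mpoly)"
  by (simp add: homogeneous_in_def)

lemma homogeneous_in_add:
  "homogeneous_in V d p \<Longrightarrow> homogeneous_in V d q \<Longrightarrow> homogeneous_in V d (p + q)"
  unfolding homogeneous_in_def by (meson Un_iff keys_add subsetD)

lemma homogeneous_in_minus:
  fixes p :: "('v, 'a :: comm_ring_1) mpoly"
  shows "homogeneous_in V d p \<Longrightarrow> homogeneous_in V d (- p)"
  by (simp add: homogeneous_in_def)

lemma homogeneous_in_sum:
  "(\<And>x. x \<in> A \<Longrightarrow> homogeneous_in V d (f x)) \<Longrightarrow> homogeneous_in V d (sum f A)"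
  by (induction A rule: infinite_finite_induct) (auto intro: homogeneous_in_add)

lemma homogeneous_in_mult:
  fixes p q :: "('v, 'a :: comm_ring_1) mpoly"
  assumes "homogeneous_in V d p" "homogeneous_in V e q"
  shows "homogeneous_in V (d + e) (p * q)"
  unfolding homogeneous_in_def
proof
  fix m assume "m \<in> Poly_Mapping.keys (p * q)"
  then obtain a b where "m = a + b" "a \<in> Poly_Mapping.keys p" "b \<in> Poly_Mapping.keys q"
    using keys_mult[of p q] by blast
  thus "Poly_Mapping.keys m \<subseteq> V \<and> mdeg m = d + e"
    using assms by (auto simp: homogeneous_in_def keys_add_nat mdeg_add)
qed

lemma homogeneous_in_prod:
  fixes f :: "'i \<Rightarrow> ('v, 'a :: comm_ring_1) mpoly"
  shows "(\<And>i. i \<in> I \<Longrightarrow> homogeneous_in V (d i) (f i)) \<Longrightarrow> homogeneous_in V (sum d I) (prod f I)"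
  by (induction I rule: infinite_finite_induct) (auto intro: homogeneous_in_mult)

text \<open>Each term of the Leibniz expansion uses every column once, so entry degrees depending
  only on the column give all terms the same degree.\<close>

lemma homogeneous_in_det:
  fixes A :: "('v, 'a :: comm_ring_1) mpoly mat"
  assumes A: "A \<in> carrier_mat n n"
    and "\<And>i j. i < n \<Longrightarrow> j < n \<Longrightarrow> homogeneous_in V (d j) (A $$ (i, j))"
  shows "homogeneous_in V (\<Sum>j<n. d j) (det A)"
  unfolding det_def'[OF A]
proof (rule homogeneous_in_sum)
  fix p assume "p \<in> {p. p permutes {0..<n}}"
  hence p: "p permutes {0..<n}" by simp
  have "homogeneous_in V (\<Sum>i = 0..<n. d (p i)) (\<Prod>i = 0..<n. A $$ (i, p i))"
    using assms(2) permutes_in_image[OF p] by (intro homogeneous_in_prod) auto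
  also have "(\<Sum>i = 0..<n. d (p i)) = (\<Sum>j<n. d j)"
    using sum.permute[OF p, of d] by (simp add: atLeast0LessThan o_def)
  finally show "homogeneous_in V (\<Sum>j<n. d j) (signof p * (\<Prod>i = 0..<n. A $$ (i, p i)))"
    by (auto simp: sign_def homogeneous_in_minus)
qed

lemma homogeneous_in_imp:
  assumes "homogeneous_in V d p"
  shows "homogeneous p" "mpoly_vars p \<subseteq> V" "total_degree p \<le> d"
  using assms by (auto simp: homogeneous_in_def homogeneous_def mpoly_vars_def total_degree_def)

text \<open>The universal series truncated to \<open>V\<close>; the variable for the coefficient at
  \<open>n\<close> is indexed by the exponent \<open>n\<close> itself.\<close>

definition generic_series :: "mindex set \<Rightarrow> (mindex, int) mpoly mseries" where
  "generic_series V =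
     Abs_mseries (\<lambda>n. if n \<in> V then Poly_Mapping.single (Poly_Mapping.single n 1) 1 else 0)"

lemma scoeff_generic_series:
  "scoeff (generic_series V) n =
     (if n \<in> V then Poly_Mapping.single (Poly_Mapping.single n 1) 1 else 0)"
  by (simp add: generic_series_def Abs_mseries_inverse)

lemma homogeneous_in_generic_series_power:
  "homogeneous_in V j (scoeff (generic_series V ^ j) n)"
proof (induction j arbitrary: n)
  case 0
  thus ?case by (simp add: one_mseries.rep_eq)
next
  case (Suc j)
  have "homogeneous_in V 1 (scoeff (generic_series V) n)" for n
    by (simp add: scoeff_generic_series homogeneous_in_def)
  from homogeneous_in_mult[OF this Suc] show ?case
    by (auto simp: scoeff_mult intro!: homogeneous_in_sum)
qed

text \<open>The matrix entry in row \<open>n\<close> and column \<open>ij\<close>, with the generic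
  series in place of a given one.\<close>

definition generic_entry :: "mindex set \<Rightarrow> mindex \<Rightarrow> mindex \<times> nat \<Rightarrow> (mindex, int) mpoly" where
  "generic_entry V n ij =
     scoeff (mseries_of_mpoly (Poly_Mapping.single (fst ij) 1) * generic_series V ^ snd ij) n"

lemma homogeneous_in_generic_entry: "homogeneous_in V (snd ij) (generic_entry V n ij)"
  unfolding generic_entry_def scoeff_mult scoeff_monomial
  using homogeneous_in_generic_series_power by (intro homogeneous_in_sum) auto

text \<open>A coefficient of degree at most \<open>N\<close> in a product involves only coefficients
  of degree at most \<open>N\<close> of the factors. Truncating the generic series is therefore
  harmless as long as \<open>y\<close> vanishes outside \<open>V\<close> in these degrees.\<close>

lemma eval_generic_entry:
  fixes y :: "'a :: comm_ring_1 mseries"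
  assumes V: "\<And>n. mdeg n \<le> N \<Longrightarrow> n \<notin> V \<Longrightarrow> scoeff y n = 0"
    and n: "mdeg n \<le> N"
  shows "eval_int_mpoly (scoeff y) (generic_entry V n ij) =
    scoeff (mseries_of_mpoly (Poly_Mapping.single (fst ij) 1) * y ^ snd ij) n"
proof -
  interpret ev: comm_ring_hom "eval_int_mpoly (scoeff y)"
    by (rule comm_ring_hom_eval_int_mpoly)
  define agree where "agree f g \<longleftrightarrow> (\<forall>n. mdeg n \<le> N \<longrightarrow> eval_int_mpoly (scoeff y) (scoeff f n) = scoeff g n)"
    for f :: "(mindex, int) mpoly mseries" and g
  have mult: "agree (f * f') (g * g')" if "agree f g" "agree f' g'" for f f' g g'
    unfolding agree_def scoeff_mult ev.hom_sum
  proof (intro allI impI sum.cong refl)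
    fix n and x :: "mindex \<times> mindex" assume "mdeg n \<le> N" "x \<in> {(a, b). a + b = n}"
    hence "mdeg (fst x) \<le> N" "mdeg (snd x) \<le> N" by (auto simp: mdeg_add)
    thus "eval_int_mpoly (scoeff y) (case x of (a, b) \<Rightarrow> scoeff f a * scoeff f' b) =
      (case x of (a, b) \<Rightarrow> scoeff g a * scoeff g' b)"
      using that by (simp add: agree_def case_prod_beta ev.hom_mult)
  qed
  have base: "agree (generic_series V) y"
    using V by (auto simp: agree_def scoeff_generic_series monomial_value_def)
  have "agree (generic_series V ^ j) (y ^ j)" for j
  proof (induction j)
    case 0
    show ?case by (simp add: agree_def one_mseries.rep_eq)
  next
    case (Suc j)
    thus ?case using mult[OF base Suc] by simp
  qed
  moreover have "agree (mseries_of_mpoly (Poly_Mapping.single i 1)) (mseries_of_mpoly (Poly_Mapping.single i 1))" for i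
    by (simp add: agree_def scoeff_monomial)
  ultimately show ?thesis
    using mult n unfolding generic_entry_def agree_def by blast
qed

subsection \<open>Linear relations from maximal minors\<close>

definition minor_mat :: "('r \<Rightarrow> 'c \<Rightarrow> 'a) \<Rightarrow> 'r list \<Rightarrow> 'c list \<Rightarrow> 'a mat" where
  "minor_mat E \<rho> \<kappa> = mat (length \<rho>) (length \<kappa>) (\<lambda>(i, j). E (\<rho> ! i) (\<kappa> ! j))"

lemma minor_mat_carrier: "minor_mat E \<rho> \<kappa> \<in> carrier_mat (length \<rho>) (length \<kappa>)"
  by (simp add: minor_mat_def)

text \<open>The minor omitting the \<open>k\<close>-th column. Its size is read off
  \<open>\<rho>\<close>, which fits when \<open>\<kappa>\<close> has one more entry.\<close>

definition skip_mat :: "('r \<Rightarrow> 'c \<Rightarrow> 'a) \<Rightarrow> 'r list \<Rightarrow> 'c list \<Rightarrow> nat \<Rightarrow> 'a mat" where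
  "skip_mat E \<rho> \<kappa> k =
     mat (length \<rho>) (length \<rho>) (\<lambda>(i, j). E (\<rho> ! i) (\<kappa> ! (if j < k then j else Suc j)))"

lemma skip_mat_carrier: "skip_mat E \<rho> \<kappa> k \<in> carrier_mat (length \<rho>) (length \<rho>)"
  by (simp add: skip_mat_def)

text \<open>The columns \<open>\<kappa>\<close> are one more than the rows \<open>\<rho>\<close>; the coefficient of the column \<open>c\<close> is the
  signed minor of \<open>\<rho>\<close> in the remaining columns.\<close>

definition minor_relation :: "('r \<Rightarrow> 'c \<Rightarrow> 'a) \<Rightarrow> 'r list \<Rightarrow> 'c list \<Rightarrow> 'c \<Rightarrow> 'a :: comm_ring_1" where
  "minor_relation E \<rho> \<kappa> c =
     (\<Sum>k<length \<kappa>. if \<kappa> ! k = c then (- 1) ^ k * det (skip_mat E \<rho> \<kappa> k) else 0)"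

text \<open>Laplace expansion along the first row \<open>n\<close>, whose cofactors are the signed
  minors of \<open>\<rho>\<close>.\<close>

lemma sum_mult_minor_relation:
  assumes "finite S" "set \<kappa> \<subseteq> S" "length \<kappa> = Suc (length \<rho>)"
  shows "(\<Sum>c\<in>S. E n c * minor_relation E \<rho> \<kappa> c) = det (minor_mat E (n # \<rho>) \<kappa>)"
proof -
  let ?M = "minor_mat E (n # \<rho>) \<kappa>"
  have M: "?M \<in> carrier_mat (length \<kappa>) (length \<kappa>)"
    using assms(3) minor_mat_carrier[of E "n # \<rho>" \<kappa>] by simp
  have "mat_delete ?M 0 k = skip_mat E \<rho> \<kappa> k" if "k < length \<kappa>" for k
    using assms(3) that by (intro eq_matI) (auto simp: mat_delete_def minor_mat_def skip_mat_def)
  moreover have "?M $$ (0, k) = E n (\<kappa> ! k)" if "k < length \<kappa>" for k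
    using that by (simp add: minor_mat_def)
  ultimately have "det ?M = (\<Sum>k<length \<kappa>. E n (\<kappa> ! k) * ((- 1) ^ k * det (skip_mat E \<rho> \<kappa> k)))"
    using assms(3) by (subst laplace_expansion_row[OF M, of 0]) (auto simp: cofactor_def)
  \<comment> \<open>The inserted sum over \<open>S\<close> passes from positions in
    \<open>\<kappa>\<close> to columns.\<close>
  also have "\<dots> = (\<Sum>k<length \<kappa>. \<Sum>c\<in>S. if \<kappa> ! k = c then
      E n c * ((- 1) ^ k * det (skip_mat E \<rho> \<kappa> k)) else 0)"
    using assms(1,2) by (intro sum.cong refl) (simp add: sum.delta subset_iff)
  also have "\<dots> = (\<Sum>c\<in>S. E n c * minor_relation E \<rho> \<kappa> c)"
    unfolding minor_relation_def sum_distrib_left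
    by (subst sum.swap) (intro sum.cong refl, auto)
  finally show ?thesis ..
qed

text \<open>The kernel vector \<open>b\<close> keeps a maximal nonzero minor from using all columns,
  so one can be added. Bordering by any row of \<open>R\<close> then gives determinant zero by
  maximality, while the coefficient of the added column is the minor itself.\<close>

lemma minor_relation_exists:
  fixes E :: "'r \<Rightarrow> 'c \<Rightarrow> 'a :: field"
  assumes S: "finite S"
    and b: "\<And>n. n \<in> R \<Longrightarrow> (\<Sum>c\<in>S. E n c * b c) = 0" "c0 \<in> S" "b c0 \<noteq> 0"
  obtains \<rho> \<kappa> where "set \<rho> \<subseteq> R" "set \<kappa> \<subseteq> S" "distinct \<kappa>" "length \<kappa> = Suc (length \<rho>)"
    "\<forall>n\<in>R. (\<Sum>c\<in>S. E n c * minor_relation E \<rho> \<kappa> c) = 0"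
    "\<exists>c\<in>S. minor_relation E \<rho> \<kappa> c \<noteq> 0"
proof -
  \<comment> \<open>Distinct columns bound the size by \<open>card S\<close>. Rows may repeat, so
    that maximality also covers bordering by a row already chosen.\<close>
  define ok where "ok q \<longleftrightarrow> (\<exists>\<rho> \<kappa>. set \<rho> \<subseteq> R \<and> set \<kappa> \<subseteq> S \<and> distinct \<kappa> \<and>
    length \<rho> = q \<and> length \<kappa> = q \<and> det (minor_mat E \<rho> \<kappa>) \<noteq> 0)" for q
  have bound: "q \<le> card S" if "ok q" for q
    using that S unfolding ok_def by (metis card_mono distinct_card)
  \<comment> \<open>The empty determinant is \<open>1\<close>.\<close>
  have "ok 0"
    unfolding ok_def by (auto intro!: exI[of _ "[]"] simp: minor_mat_def)
  hence "ok (Greatest ok)"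
    using bound by (rule GreatestI_nat) auto
  moreover have max: "\<not> ok (Suc (Greatest ok))"
    using Greatest_le_nat[of ok "Suc (Greatest ok)" "card S"] bound by auto
  ultimately obtain \<rho> \<kappa> where *: "set \<rho> \<subseteq> R" "set \<kappa> \<subseteq> S" "distinct \<kappa>"
    "length \<rho> = Greatest ok" "length \<kappa> = Greatest ok" and det: "det (minor_mat E \<rho> \<kappa>) \<noteq> 0"
    unfolding ok_def[of "Greatest ok"] by blast
  define q where "q = length \<rho>"
  have q: "length \<rho> = q" "length \<kappa> = q" using * by (auto simp: q_def)
  \<comment> \<open>Otherwise \<open>b\<close>, listed along \<open>\<kappa>\<close>, is a nonzero
    kernel vector of a matrix with nonzero determinant.\<close>
  have "set \<kappa> \<noteq> S"
  proof
    assume eq: "set \<kappa> = S"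
    let ?M = "minor_mat E \<rho> \<kappa>"
    have M: "?M \<in> carrier_mat q q" using minor_mat_carrier[of E \<rho> \<kappa>] q by simp
    define v where "v = vec q (\<lambda>j. b (\<kappa> ! j))"
    have v: "v \<in> carrier_vec q" by (simp add: v_def)
    obtain j where j: "j < q" "\<kappa> ! j = c0" using b(2) eq q by (metis in_set_conv_nth)
    hence "v $ j \<noteq> 0" using b(3) by (simp add: v_def)
    hence "v \<noteq> 0\<^sub>v q" using j by auto
    moreover have "?M *\<^sub>v v = 0\<^sub>v q"
    proof (rule eq_vecI)
      fix i assume "i < dim_vec (0\<^sub>v q :: 'a vec)"
      hence i: "i < q" by simp
      have "(?M *\<^sub>v v) $ i = (\<Sum>j<q. E (\<rho> ! i) (\<kappa> ! j) * b (\<kappa> ! j))"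
        using i q by (simp add: minor_mat_def v_def scalar_prod_def atLeast0LessThan)
      also have "\<dots> = (\<Sum>c\<in>S. E (\<rho> ! i) c * b c)"
        using bij_betw_nth[OF *(3) refl eq[symmetric]] q
        by (intro sum.reindex_bij_betw[of "(!) \<kappa>"]) simp
      also have "\<dots> = 0" using i q *(1) by (intro b(1)) (metis nth_mem subsetD)
      finally show "(?M *\<^sub>v v) $ i = 0\<^sub>v q $ i" using i by simp
    qed (use M in simp)
    ultimately show False
      using det det_0_iff_vec_prod_zero_field[OF M] v by blast
  qed
  then obtain c1 where c1: "c1 \<in> S" "c1 \<notin> set \<kappa>" using *(2) by blast
  let ?\<kappa> = "c1 # \<kappa>"
  have zero: "(\<Sum>c\<in>S. E n c * minor_relation E \<rho> ?\<kappa> c) = 0" if "n \<in> R" for n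
  proof -
    have "det (minor_mat E (n # \<rho>) ?\<kappa>) = 0"
      using max that * c1 unfolding ok_def[of "Suc (Greatest ok)"]
      by (metis (no_types, lifting) distinct.simps(2) insert_subset length_Cons list.simps(15))
    thus ?thesis using sum_mult_minor_relation[of S ?\<kappa> \<rho> E n] S * c1 by simp
  qed
  \<comment> \<open>\<open>c1\<close> occurs in the new list only at position \<open>0\<close>,
    where the sign is \<open>1\<close>.\<close>
  have "minor_relation E \<rho> ?\<kappa> c1 = (\<Sum>k\<in>{0}. if ?\<kappa> ! k = c1 then (- 1) ^ k * det (skip_mat E \<rho> ?\<kappa> k) else 0)"
    unfolding minor_relation_def
  proof (rule sum.mono_neutral_right)
    show "\<forall>k\<in>{..<length ?\<kappa>} - {0}. (if ?\<kappa> ! k = c1 then (- 1) ^ k * det (skip_mat E \<rho> ?\<kappa> k) else 0) = 0"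
      using c1(2) by (auto simp: nth_Cons')
  qed auto
  also have "\<dots> = det (skip_mat E \<rho> ?\<kappa> 0)" by simp
  also have "skip_mat E \<rho> ?\<kappa> 0 = minor_mat E \<rho> \<kappa>"
    using q by (intro eq_matI) (auto simp: skip_mat_def minor_mat_def)
  finally have "minor_relation E \<rho> ?\<kappa> c1 \<noteq> 0" using det by simp
  thus thesis
    using that[of \<rho> ?\<kappa>] zero * c1 by auto
qed

lemma (in comm_ring_hom) hom_minor_relation:
  "hom (minor_relation E \<rho> \<kappa> c) = minor_relation (\<lambda>n c. hom (E n c)) \<rho> \<kappa> c"
proof -
  have "hom (det (skip_mat E \<rho> \<kappa> k)) = det (skip_mat (\<lambda>n c. hom (E n c)) \<rho> \<kappa> k)" for k
  proof -
    have "map_mat hom (skip_mat E \<rho> \<kappa> k) = skip_mat (\<lambda>n c. hom (E n c)) \<rho> \<kappa> k"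
      by (rule eq_matI) (auto simp: skip_mat_def)
    thus ?thesis by (metis hom_det)
  qed
  thus ?thesis
    unfolding minor_relation_def hom_sum
    by (intro sum.cong refl) (auto simp: hom_distribs)
qed

text \<open>Omitting the position of \<open>c\<close> leaves a minor on the other columns, whose
  degrees add up. If \<open>c\<close> is not in \<open>\<kappa>\<close>, its coefficient is zero and
  has every degree.\<close>

lemma homogeneous_in_minor_relation:
  fixes E :: "'r \<Rightarrow> 'c \<Rightarrow> ('v, 'a :: comm_ring_1) mpoly"
  assumes E: "\<And>n c. homogeneous_in V (e c) (E n c)"
    and \<kappa>: "distinct \<kappa>" "length \<kappa> = Suc (length \<rho>)"
  shows "homogeneous_in V (\<Sum>c'\<in>set \<kappa> - {c}. e c') (minor_relation E \<rho> \<kappa> c)"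
  unfolding minor_relation_def
proof (rule homogeneous_in_sum)
  fix k assume "k \<in> {..<length \<kappa>}"
  hence k: "k < length \<kappa>" by simp
  let ?q = "length \<rho>"
  let ?s = "\<lambda>j. if j < k then j else Suc j"
  have s: "bij_betw ?s {..<?q} ({..<length \<kappa>} - {k})"
    by (rule bij_betw_byWitness[where f' = "\<lambda>j. if j < k then j else j - 1"])
       (use \<kappa> k in \<open>auto split: if_splits\<close>)
  have "bij_betw ((!) \<kappa>) ({..<length \<kappa>} - {k}) (set \<kappa> - {\<kappa> ! k})"
    using bij_betw_DiffI[OF bij_betw_nth[OF \<kappa>(1) refl refl], of "{k}" "{\<kappa> ! k}"] k by simp
  from bij_betw_trans[OF s this]
  have "(\<Sum>j<?q. e (\<kappa> ! ?s j)) = (\<Sum>c'\<in>set \<kappa> - {\<kappa> ! k}. e c')"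
    using sum.reindex_bij_betw[of "(!) \<kappa> \<circ> ?s" "{..<?q}" "set \<kappa> - {\<kappa> ! k}" e] by (simp add: o_def)
  moreover have "homogeneous_in V (\<Sum>j<?q. e (\<kappa> ! ?s j)) (det (skip_mat E \<rho> \<kappa> k))"
    by (rule homogeneous_in_det[OF skip_mat_carrier]) (simp add: skip_mat_def E)
  ultimately have "homogeneous_in V (\<Sum>c'\<in>set \<kappa> - {\<kappa> ! k}. e c') (det (skip_mat E \<rho> \<kappa> k))"
    by simp
  hence "homogeneous_in V (\<Sum>c'\<in>set \<kappa> - {\<kappa> ! k}. e c') ((- 1) ^ k * det (skip_mat E \<rho> \<kappa> k))"
    by (cases "even k") (auto simp: homogeneous_in_minus)
  thus "homogeneous_in V (\<Sum>c'\<in>set \<kappa> - {c}. e c')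
    (if \<kappa> ! k = c then (- 1) ^ k * det (skip_mat E \<rho> \<kappa> k) else 0)"
    by auto
qed

subsection \<open>Polynomials with prescribed support\<close>

text \<open>The image of \<open>poly_with_support S a\<close> over the ring of series, where the
  resultant argument takes place.\<close>

definition series_poly ::
    "(mindex \<times> nat) set \<Rightarrow> (mindex \<times> nat \<Rightarrow> 'a :: comm_ring_1) \<Rightarrow> 'a mseries poly" where
  "series_poly S a =
     (\<Sum>c\<in>S. monom (mseries_of_mpoly (Poly_Mapping.single (fst c) (a c))) (snd c))"

lemma map_poly_mseries_of_mpoly_support:
  "map_poly mseries_of_mpoly (poly_with_support S a) = series_poly S a"
proof (rule poly_eqI)
  fix k
  have zero: "mseries_of_mpoly (0 :: (nat, 'a) mpoly) = 0"
    by (simp add: mseries_eq_iff scoeff_mseries_of_mpoly zero_mseries.rep_eq)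
  have add: "mseries_of_mpoly (p + q) = mseries_of_mpoly p + mseries_of_mpoly q"
    for p q :: "(nat, 'a) mpoly"
    by (simp add: mseries_eq_iff scoeff_mseries_of_mpoly plus_mseries.rep_eq lookup_add)
  have "mseries_of_mpoly (sum f S) = (\<Sum>c\<in>S. mseries_of_mpoly (f c))" for f :: "mindex \<times> nat \<Rightarrow> (nat, 'a) mpoly"
    by (induction S rule: infinite_finite_induct) (auto simp: zero add)
  thus "coeff (map_poly mseries_of_mpoly (poly_with_support S a)) k = coeff (series_poly S a) k"
    by (simp add: coeff_map_poly zero poly_with_support_def series_poly_def coeff_sum case_prod_beta)
      (intro sum.cong refl, auto simp: coeff_monom zero)
qed

lemma vanishes_at_support:
  "vanishes_at (poly_with_support S a) y \<longleftrightarrow> poly (series_poly S a) y = 0"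
  by (simp add: vanishes_at_def map_poly_mseries_of_mpoly_support)

lemma scoeff_coeff_series_poly:
  assumes "finite S"
  shows "scoeff (coeff (series_poly S a) j) i = (if (i, j) \<in> S then a (i, j) else 0)"
proof -
  have "scoeff (coeff (series_poly S a) j) i = (\<Sum>c\<in>S. if c = (i, j) then a c else 0)"
    unfolding series_poly_def coeff_sum scoeff_sum
    by (intro sum.cong refl) (auto simp: coeff_monom scoeff_monomial zero_mseries.rep_eq)
  thus ?thesis using assms by simp
qed

lemma series_poly_nonzero:
  assumes "finite S" "c \<in> S" "a c \<noteq> 0"
  shows "series_poly S a \<noteq> 0"
  using scoeff_coeff_series_poly[OF assms(1), of a "snd c" "fst c"] assms(2,3)
  by (auto simp: zero_mseries.rep_eq)

lemma poly_with_support_nonzero: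
  assumes "finite S" "c \<in> S" "a c \<noteq> 0"
  shows "poly_with_support S a \<noteq> 0"
  using series_poly_nonzero[of S c a, OF assms] map_poly_mseries_of_mpoly_support[of S a] by auto

text \<open>Reads evaluation at \<open>y\<close> as a matrix product: the entries depend on
  \<open>y\<close> only, and the vector is \<open>a\<close>.\<close>

lemma scoeff_poly_series_poly:
  "scoeff (poly (series_poly S a) y) n =
     (\<Sum>c\<in>S. scoeff (mseries_of_mpoly (Poly_Mapping.single (fst c) 1) * y ^ snd c) n * a c)"
  unfolding series_poly_def poly_sum poly_monom scoeff_sum
  by (intro sum.cong refl, subst scoeff_monomial_mult) (simp add: mult.commute)

lemma coeffs_deg_le_series_poly:
  assumes "finite S" "\<And>c. c \<in> S \<Longrightarrow> mdeg (fst c) \<le> d"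
  shows "coeffs_deg_le d (series_poly S a)"
  using assms(2) by (force simp: coeffs_deg_le_def deg_le_def scoeff_coeff_series_poly[OF assms(1)] split: if_splits)

lemma degree_series_poly:
  assumes "finite S" "\<And>c. c \<in> S \<Longrightarrow> snd c \<le> d"
  shows "degree (series_poly S a) \<le> d"
  unfolding series_poly_def using assms
  by (intro degree_sum_le) (auto intro: order_trans[OF degree_monom_le])

section \<open>Supports and extreme exponents in \<open>r\<close> variables\<close>

lemma scoeff_power_eq_0:
  fixes y :: "'a :: comm_ring_1 mseries"
  assumes "y \<in> mseries_in r" "n \<notin> mindices r"
  shows "scoeff (y ^ j) n = 0"
  using assms(2)
proof (induction j arbitrary: n)
  case 0
  thus ?case by (auto simp: one_mseries.rep_eq)
next
  case (Suc j)
  show ?case unfolding power_Suc scoeff_mult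
  proof (rule sum.neutral, clarify)
    fix a b assume "n = a + b"
    hence "a \<notin> mindices r \<or> b \<notin> mindices r" using Suc.prems by (simp add: mindices_add_iff)
    moreover have "scoeff y a = 0" if "a \<notin> mindices r"
      using assms(1) that by (auto simp: mseries_in_def)
    ultimately show "scoeff y a * scoeff (y ^ j) b = 0"
      using Suc.IH by auto
  qed
qed

text \<open>Covers the exponents involving further variables of the series type, so that rows from
  \<open>mindices r\<close> decide the order of the value at \<open>y\<close>.\<close>

lemma scoeff_poly_series_poly_eq_0:
  fixes y :: "'a :: comm_ring_1 mseries"
  assumes "y \<in> mseries_in r" "n \<notin> mindices r" "\<And>c. c \<in> S \<Longrightarrow> fst c \<in> mindices r"
  shows "scoeff (poly (series_poly S a) y) n = 0"
  unfolding scoeff_poly_series_poly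
proof (rule sum.neutral, rule ballI)
  fix c assume c: "c \<in> S"
  have "scoeff (mseries_of_mpoly (Poly_Mapping.single (fst c) 1) * y ^ snd c) n = 0"
    unfolding scoeff_mult
  proof (rule sum.neutral, clarify)
    fix a b assume "n = a + b"
    hence "a \<notin> mindices r \<or> b \<notin> mindices r" using assms(2) by (simp add: mindices_add_iff)
    thus "scoeff (mseries_of_mpoly (Poly_Mapping.single (fst c) 1)) a * scoeff (y ^ snd c) b = 0"
      using assms(3)[OF c] scoeff_power_eq_0[OF assms(1)] by (auto simp: scoeff_monomial)
  qed
  thus "scoeff (mseries_of_mpoly (Poly_Mapping.single (fst c) 1) * y ^ snd c) n * a c = 0" by simp
qed

text \<open>An exponent lexicographically below \<open>single r 1\<close> first differs from it at
  \<open>r\<close>, so all its coordinates are zero.\<close>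

lemma grlex_ge_smallest:
  assumes "n \<in> mindices r" "n \<noteq> 0"
  shows "grlex_le (Poly_Mapping.single r 1) n"
proof -
  have "\<not> n < Poly_Mapping.single r 1"
  proof
    assume "n < Poly_Mapping.single r 1"
    then obtain k where k: "Poly_Mapping.lookup n k < Poly_Mapping.lookup (Poly_Mapping.single r 1) k"
      "\<forall>k'<k. Poly_Mapping.lookup n k' = Poly_Mapping.lookup (Poly_Mapping.single r 1) k'"
      unfolding less_poly_mapping.rep_eq less_fun_def by blast
    hence "k = r" by (auto simp: lookup_single when_def split: if_splits)
    hence "Poly_Mapping.lookup n v = 0" for v
    proof (cases v r rule: linorder_cases)
      case greater
      thus ?thesis using assms(1) by (auto simp: mindices_def in_keys_iff subset_iff)
    qed (use k in \<open>auto simp: lookup_single when_def\<close>)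
    thus False using assms(2) by (metis lookup_zero poly_mapping_eqI)
  qed
  moreover have "1 \<le> mdeg n" using assms(2) by (metis mdeg_eq_0_iff less_one not_less)
  ultimately show ?thesis by (auto simp: grlex_le_def)
qed

text \<open>If \<open>n\<close> were lexicographically larger, the first difference could not be at
  coordinate \<open>1\<close>, which is at most \<open>N\<close>. A later one would come on top of a
  first coordinate equal to \<open>N\<close> and push the degree beyond \<open>N\<close>.\<close>

lemma grlex_le_largest:
  assumes "n \<in> mindices r" "mdeg n \<le> N"
  shows "grlex_le n (Poly_Mapping.single 1 N)"
proof -
  have "\<not> Poly_Mapping.single 1 N < n"
  proof
    assume "Poly_Mapping.single 1 N < n"
    then obtain k where k: "Poly_Mapping.lookup (Poly_Mapping.single 1 N) k < Poly_Mapping.lookup n k"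
      "\<forall>k'<k. Poly_Mapping.lookup (Poly_Mapping.single 1 N) k' = Poly_Mapping.lookup n k'"
      unfolding less_poly_mapping.rep_eq less_fun_def by blast
    have "Poly_Mapping.lookup n 0 = 0"
      using assms(1) by (auto simp: mindices_def in_keys_iff subset_iff)
    hence "k \<noteq> 0" using k(1) by (metis not_less_zero)
    moreover have "k \<noteq> 1"
      using k(1) lookup_le_mdeg[of n 1] assms(2) by auto
    ultimately have "1 < k" by simp
    hence 1: "Poly_Mapping.lookup n 1 = N" using k(2) by auto
    have "(\<Sum>v\<in>{1, k}. Poly_Mapping.lookup n v) \<le> (\<Sum>v\<in>Poly_Mapping.keys n \<union> {1, k}. Poly_Mapping.lookup n v)"
      by (intro sum_mono2) auto
    also have "\<dots> = mdeg n" by (rule mdeg_superset[symmetric]) auto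
    finally show False using 1 \<open>1 < k\<close> k(1) assms(2) by simp
  qed
  thus ?thesis using assms(2) by (auto simp: grlex_le_def)
qed

text \<open>\<open>F\<close> lies in the product of the exponents of degree at most
  \<open>dx\<close> with \<open>{1..dy}\<close>, and \<open>j\<close> is summed over all of it. The
  factor \<open>2\<close> avoids division.\<close>

lemma sum_snd_le:
  fixes F :: "(mindex \<times> nat) set"
  assumes "\<And>i j. (i, j) \<in> F \<Longrightarrow> i \<in> mindices r \<and> mdeg i \<le> dx \<and> 1 \<le> j \<and> j \<le> dy"
  shows "2 * sum snd F \<le> dy * (dy + 1) * ((dx + r) choose r)"
proof -
  let ?I = "{i \<in> mindices r. mdeg i \<le> dx}"
  have "finite ?I"
    by (rule finite_subset[OF _ finite_mdeg_le[of "{1..r}" dx]]) (auto simp: mindices_def)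
  hence "sum snd F \<le> sum snd (?I \<times> {1..dy})"
    using assms by (intro sum_mono2) auto
  also have "\<dots> = card ?I * \<Sum>{1..dy}"
    by (simp only: sum.cartesian_product' snd_conv sum_constant of_nat_id)
  finally have "2 * sum snd F \<le> card ?I * (2 * \<Sum>{1..dy})"
    by simp
  also have "2 * \<Sum>{1..dy} = dy * (dy + 1)"
    by (induction dy) auto
  also have "card ?I * (dy * (dy + 1)) \<le> ((dx + r) choose r) * (dy * (dy + 1))"
    using card_mdeg_le by (intro mult_right_mono) auto
  finally show ?thesis by (simp add: mult.commute)
qed

section \<open>Finitely many relations serving all algebraic series\<close>

theorem theorem3p5:
  fixes r dx dy N :: nat
    and F G :: "(mindex \<times> nat) list"
  assumes "r \<ge> 2"
    and "F \<noteq> []"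
    and "sorted_wrt alex_less F"
    and "sorted_wrt alex_less G"
    and "\<forall>(i, j)\<in>set F. i \<in> mindices r \<and> j \<ge> 1"
    and "\<forall>(i, j)\<in>set G. i \<in> mindices r \<and> mdeg i > 0 \<and> j = 0"
    and "dy = Max {j. \<exists>i. (i, j) \<in> set F}"
    and "dx = Max {mdeg i | i j. (i, j) \<in> set F \<union> set G}"
    and "N = 2 * dx * dy"
  shows "\<exists>(\<Lambda> :: nat set) (a :: nat \<Rightarrow> mindex \<times> nat \<Rightarrow> (mindex, int) mpoly).
    finite \<Lambda> \<and>
    (\<forall>l\<in>\<Lambda>. \<forall>(i, j)\<in>set F \<union> set G.
       homogeneous (a l (i, j)) \<and>
       mpoly_vars (a l (i, j)) \<subseteq>
         {n \<in> mindices r. grlex_le (Poly_Mapping.single r 1) n \<and> grlex_le n (Poly_Mapping.single 1 N)}) \<and>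
    (\<forall>l\<in>\<Lambda>. \<forall>(i, j)\<in>set F.
       real (total_degree (a l (i, j))) \<le>
         1 / 2 * real dy * (real dy + 1) * real ((dx + r) choose r) - 1) \<and>
    (\<forall>l\<in>\<Lambda>. \<forall>(i, j)\<in>set G.
       real (total_degree (a l (i, j))) \<le>
         1 / 2 * real dy * (real dy + 1) * real ((dx + r) choose r) - 1 + real (mdeg i)) \<and>
    (\<forall>y0 :: 'k :: field mseries.
       y0 \<in> mseries_in r \<longrightarrow>
       (\<forall>n. scoeff y0 n \<noteq> 0 \<longrightarrow> grlex_le (Poly_Mapping.single r 1) n) \<longrightarrow>
       scoeff y0 (Poly_Mapping.single r 1) \<noteq> 0 \<longrightarrow>
       algebraic_rel F G y0 \<longrightarrow>
       (\<exists>l\<in>\<Lambda>.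
          let P = poly_with_support (set F) (\<lambda>ij. eval_int_mpoly (scoeff y0) (a l ij)) +
                  poly_with_support (set G) (\<lambda>ij. eval_int_mpoly (scoeff y0) (a l ij))
          in P \<noteq> 0 \<and> vanishes_at P y0))"
proof -
  define S where "S = set F \<union> set G"
  \<comment> \<open>\<open>V\<close> indexes the variables and omits \<open>0\<close>, as the series
    have no constant term; \<open>R\<close> indexes the equations and keeps
    \<open>0\<close>.\<close>
  define V where "V = {n \<in> mindices r. n \<noteq> 0 \<and> mdeg n \<le> N}"
  define R where "R = {n \<in> mindices r. mdeg n \<le> N}"
  have S: "finite S" by (simp add: S_def)
  have R: "finite R"
    by (rule finite_subset[OF _ finite_mdeg_le[of "{1..r}" N]]) (auto simp: R_def mindices_def)
  have S_in: "fst c \<in> mindices r" if "c \<in> S" for c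
    using that assms(5,6) by (auto simp: S_def)
  have S_dx: "mdeg (fst c) \<le> dx" if "c \<in> S" for c
  proof -
    have "{mdeg i | i j. (i, j) \<in> set F \<union> set G} = (\<lambda>c. mdeg (fst c)) ` S"
      by (force simp: S_def)
    thus ?thesis using S that assms(8) by simp
  qed
  have F_dy: "snd c \<le> dy" if "c \<in> set F" for c
  proof -
    have "{j. \<exists>i. (i, j) \<in> set F} = snd ` set F" by force
    thus ?thesis using that assms(7) by simp
  qed
  have S_dy: "snd c \<le> dy" if "c \<in> S" for c
    using that F_dy assms(6) by (cases c) (fastforce simp: S_def)
  have disj: "set F \<inter> set G = {}" using assms(5,6) by fastforce
  define Par where "Par = {(\<rho>, \<kappa>). set \<rho> \<subseteq> R \<and> set \<kappa> \<subseteq> S \<and> distinct \<kappa> \<and> length \<kappa> = Suc (length \<rho>)}"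
  have "finite Par"
  proof (rule finite_subset)
    have "length \<kappa> \<le> card S" if "set \<kappa> \<subseteq> S" "distinct \<kappa>" for \<kappa>
      using that S by (metis card_mono distinct_card)
    thus "Par \<subseteq> {\<rho>. set \<rho> \<subseteq> R \<and> length \<rho> \<le> card S} \<times> {\<kappa>. set \<kappa> \<subseteq> S \<and> length \<kappa> \<le> card S}"
      by (fastforce simp: Par_def)
  qed (intro finite_cartesian_product finite_lists_length_le S R)
  define rel where "rel \<rho>\<kappa> = minor_relation (generic_entry V) (fst \<rho>\<kappa>) (snd \<rho>\<kappa>)" for \<rho>\<kappa>
  \<comment> \<open>The index set has to consist of naturals, so the finite set of relations is
    enumerated.\<close>
  obtain m :: nat and a where a: "rel ` Par = a ` {i. i < m}"
    using finite_imp_nat_seg_image_inj_on[of "rel ` Par"] \<open>finite Par\<close> by blast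
  \<comment> \<open>The sum of the degrees of all columns; those from \<open>G\<close> contribute
    zero.\<close>
  define B where "B = sum snd S"
  have B_F: "B = sum snd (set F)"
    unfolding B_def S_def using disj assms(6) by (subst sum.union_disjoint) auto
  have "2 * B \<le> dy * (dy + 1) * ((dx + r) choose r)"
    unfolding B_F using assms(5) S_dx F_dy by (intro sum_snd_le) (force simp: S_def)
  hence "real (2 * B) \<le> real (dy * (dy + 1) * ((dx + r) choose r))"
    by (simp only: of_nat_le_iff)
  hence B: "real B \<le> 1 / 2 * real dy * (real dy + 1) * real ((dx + r) choose r)"
    by (simp add: algebra_simps)
  \<comment> \<open>The coefficient of \<open>c\<close> omits the column \<open>c\<close>, which
    saves \<open>snd c\<close>. The degree \<open>e\<close> depends on the chosen columns and may be
    smaller than \<open>B - snd c\<close>.\<close>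
  have a_hom: "\<exists>e. homogeneous_in V e (a l c) \<and> e + snd c \<le> B" if l: "l < m" and c: "c \<in> S" for l c
  proof -
    obtain \<rho> \<kappa> where par: "(\<rho>, \<kappa>) \<in> Par" "a l = minor_relation (generic_entry V) \<rho> \<kappa>"
      using a l unfolding rel_def by force
    have "homogeneous_in V (\<Sum>c'\<in>set \<kappa> - {c}. snd c') (a l c)"
      unfolding par(2) using par(1) homogeneous_in_generic_entry
      by (intro homogeneous_in_minor_relation) (auto simp: Par_def)
    moreover have "(\<Sum>c'\<in>set \<kappa> - {c}. snd c') \<le> (\<Sum>c'\<in>S - {c}. snd c')"
      using S par(1) by (intro sum_mono2) (auto simp: Par_def)
    moreover have "(\<Sum>c'\<in>S - {c}. snd c') + snd c = B"
      unfolding B_def using S c by (simp add: sum.remove[of S c snd])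
    ultimately show ?thesis by force
  qed
  have V_vars: "V \<subseteq> {n \<in> mindices r. grlex_le (Poly_Mapping.single r 1) n \<and> grlex_le n (Poly_Mapping.single 1 N)}"
    using grlex_ge_smallest grlex_le_largest by (auto simp: V_def)
  have P: "\<exists>l<m. (\<exists>c\<in>S. eval_int_mpoly (scoeff y) (a l c) \<noteq> 0) \<and>
      poly (series_poly S (\<lambda>c. eval_int_mpoly (scoeff y) (a l c))) y = 0"
    if y: "y \<in> mseries_in r" "\<forall>n. scoeff y n \<noteq> 0 \<longrightarrow> grlex_le (Poly_Mapping.single r 1) n"
      "algebraic_rel F G y" for y :: "'k mseries"
  proof -
    interpret ev: comm_ring_hom "eval_int_mpoly (scoeff y)"
      by (rule comm_ring_hom_eval_int_mpoly)
    define E where "E n c = eval_int_mpoly (scoeff y) (generic_entry V n c)" for n c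
    \<comment> \<open>Such an \<open>n\<close> is either zero or involves a variable outside
      \<open>{1..r}\<close>.\<close>
    have "scoeff y n = 0" if "mdeg n \<le> N" "n \<notin> V" for n
      using that y(1,2) by (auto simp: V_def mseries_in_def grlex_le_def)
    hence E: "E n c = scoeff (mseries_of_mpoly (Poly_Mapping.single (fst c) 1) * y ^ snd c) n"
      if "mdeg n \<le> N" for n c
      unfolding E_def using that by (intro eval_generic_entry)
    have coeff_poly: "scoeff (poly (series_poly S b) y) n = (\<Sum>c\<in>S. E n c * b c)" if "mdeg n \<le> N" for n b
      using E[OF that] by (simp add: scoeff_poly_series_poly)
    obtain b where b: "poly_with_support S b \<noteq> 0" "poly (series_poly S b) y = 0"
      using y(3) unfolding algebraic_rel_def vanishes_at_support S_def by blast
    have "\<exists>c\<in>S. b c \<noteq> 0"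
    proof (rule ccontr)
      assume "\<not> (\<exists>c\<in>S. b c \<noteq> 0)"
      hence "poly_with_support S b = 0"
        unfolding poly_with_support_def by (intro sum.neutral) auto
      thus False using b(1) by simp
    qed
    then obtain c0 where c0: "c0 \<in> S" "b c0 \<noteq> 0" by blast
    \<comment> \<open>Algebraicity supplies the kernel vector which forces the matrix to have
      dependent columns.\<close>
    have kernel: "(\<Sum>c\<in>S. E n c * b c) = 0" if "n \<in> R" for n
      using that coeff_poly[of n b] b(2) by (simp add: R_def zero_mseries.rep_eq)
    obtain \<rho> \<kappa> where *: "set \<rho> \<subseteq> R" "set \<kappa> \<subseteq> S" "distinct \<kappa>" "length \<kappa> = Suc (length \<rho>)"
      "\<forall>n\<in>R. (\<Sum>c\<in>S. E n c * minor_relation E \<rho> \<kappa> c) = 0"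
      "\<exists>c\<in>S. minor_relation E \<rho> \<kappa> c \<noteq> 0"
      by (rule minor_relation_exists[of S R E b c0, OF S kernel c0])
    have "(\<rho>, \<kappa>) \<in> Par" using * by (simp add: Par_def)
    hence "minor_relation (generic_entry V) \<rho> \<kappa> \<in> a ` {i. i < m}"
      unfolding a[symmetric] rel_def by force
    then obtain l where l: "l < m" "a l = minor_relation (generic_entry V) \<rho> \<kappa>" by auto
    have al: "eval_int_mpoly (scoeff y) (a l c) = minor_relation E \<rho> \<kappa> c" for c
      unfolding l(2) ev.hom_minor_relation E_def ..
    let ?Q = "series_poly S (minor_relation E \<rho> \<kappa>)"
    have "scoeff (poly ?Q y) n = 0" if "mdeg n \<le> N" for n
    proof (cases "n \<in> mindices r")
      case True
      thus ?thesis using that coeff_poly *(5) by (simp add: R_def)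
    next
      case False
      show ?thesis by (rule scoeff_poly_series_poly_eq_0[OF y(1) False S_in])
    qed
    hence "order_ge (Suc (2 * dx * dy)) (poly ?Q y)"
      by (simp add: order_ge_def assms(9) less_Suc_eq_le)
    \<comment> \<open>The given relation \<open>b\<close>, though unknown, plays the role of
      \<open>P\<close> in the resultant argument and certifies the relation built from
      minors.\<close>
    hence "poly ?Q y = 0"
      using series_poly_nonzero[of S c0 b] S c0 b(2) S_dx S_dy
      by (intro poly_eq_0_of_order_ge[of "series_poly S b" dy dx y ?Q])
         (auto intro!: degree_series_poly coeffs_deg_le_series_poly)
    thus ?thesis using l(1) *(6) by (intro exI[of _ l]) (simp add: al)
  qed
  show ?thesis
  proof (intro exI[of _ "{i. i < m}"] exI[of _ a] conjI ballI allI impI)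
    fix l c assume "l \<in> {i. i < m}" "c \<in> set F \<union> set G"
    then obtain e where "homogeneous_in V e (a l c)" using a_hom[of l c] by (auto simp: S_def)
    thus "case c of (i, j) \<Rightarrow> homogeneous (a l (i, j)) \<and> mpoly_vars (a l (i, j)) \<subseteq>
      {n \<in> mindices r. grlex_le (Poly_Mapping.single r 1) n \<and> grlex_le n (Poly_Mapping.single 1 N)}"
      using homogeneous_in_imp[of V e "a l c"] V_vars by auto
  next
    fix l c assume "l \<in> {i. i < m}" and c: "c \<in> set F"
    then obtain e where e: "homogeneous_in V e (a l c)" "e + snd c \<le> B"
      using a_hom[of l c] by (auto simp: S_def)
    have "total_degree (a l c) + 1 \<le> B"
      using homogeneous_in_imp(3)[OF e(1)] e(2) c assms(5) by force
    thus "case c of (i, j) \<Rightarrow> real (total_degree (a l (i, j))) \<le>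
      1 / 2 * real dy * (real dy + 1) * real ((dx + r) choose r) - 1"
      using B by (cases c) auto
  next
    fix l c assume "l \<in> {i. i < m}" and c: "c \<in> set G"
    then obtain e where e: "homogeneous_in V e (a l c)" "e + snd c \<le> B"
      using a_hom[of l c] by (auto simp: S_def)
    have "total_degree (a l c) + 1 \<le> B + mdeg (fst c)"
      using homogeneous_in_imp(3)[OF e(1)] e(2) c assms(6) by force
    thus "case c of (i, j) \<Rightarrow> real (total_degree (a l (i, j))) \<le>
      1 / 2 * real dy * (real dy + 1) * real ((dx + r) choose r) - 1 + real (mdeg i)"
      using B by (cases c) auto
  next
    fix y0 :: "'k mseries"
    assume "y0 \<in> mseries_in r" "\<forall>n. scoeff y0 n \<noteq> 0 \<longrightarrow> grlex_le (Poly_Mapping.single r 1) n"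
      "algebraic_rel F G y0"
    from P[OF this] obtain l c where l: "l < m" "c \<in> S" "eval_int_mpoly (scoeff y0) (a l c) \<noteq> 0"
      "poly (series_poly S (\<lambda>c. eval_int_mpoly (scoeff y0) (a l c))) y0 = 0" by blast
    have sum: "poly_with_support (set F) b + poly_with_support (set G) b = poly_with_support S b"
      for b :: "mindex \<times> nat \<Rightarrow> 'k"
      unfolding poly_with_support_def S_def using disj by (subst sum.union_disjoint) auto
    show "\<exists>l\<in>{i. i < m}.
      let P = poly_with_support (set F) (\<lambda>ij. eval_int_mpoly (scoeff y0) (a l ij)) +
              poly_with_support (set G) (\<lambda>ij. eval_int_mpoly (scoeff y0) (a l ij))
      in P \<noteq> 0 \<and> vanishes_at P y0"
      using l poly_with_support_nonzero[OF S l(2), of "\<lambda>c. eval_int_mpoly (scoeff y0) (a l c)"]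
      by (intro bexI[of _ l]) (auto simp: sum Let_def vanishes_at_support)
  qed simp
qed

end
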